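(* Let $G$ be a finitely generated amenable group admitting a controlled Følner sequence. Let $\pi$ be a uniformly bounded $c_0$-representation of $G$ on a superreflexive Banach space $\mathcal E$. Then the first reduced cohomology vanishes, $H^1_{\mathrm{red}}(G,\pi)=0$. Equivalently, every $1$-cocycle $b\colon G\to\mathcal E$ for $\pi$ is an almost coboundary.
   Context: $G$ is a discrete group with a fixed finite symmetric generating set $S$, word length $|\cdot|$ and word metric $d(g,h)=|g^{-1}h|$. For a finite set $F\subset G$, $\mathrm{diam}(F)$ is its diameter for $d$, and $\partial F=\{g\in F: gs\notin F \text{ for some } s\in S\}$ is its boundary in the Cayley graph. A Følner sequence is a sequence $(F_n)_{n\ge1}$ of finite non-empty subsets of $G$ with $|\partial F_n|/|F_n|\to 0$. A controlled Følner sequence is a Følner sequence $(F_n)_{n\ge 1}$ for which there exists $C>0$ with $|\partial F_n|\le \dfrac{C|F_n|}{\mathrm{diam}(F_n)}$ for every $n\ge1$ (read as $|\partial F_n|\,\mathrm{diam}(F_n)\le C|F_n|$ when the diameter is $0$). A representation $\pi\colon G\to\mathrm{GL}(\mathcal E)$ is a homomorphism into the group of bounded linear isomorphisms of the Banach space $\mathcal E$. It is uniformly bounded if there is $C'>0$ with $\lVert\pi(g)\rVert\le C'$ for all $g\in G$. It is a $c_0$-representation if for every $\xi\in\mathcal E$ and every $\varphi\in\mathcal E^*$ one has $\varphi(\pi(g)\xi)\to 0$ as $g\to\infty$ (i.e. as $g$ leaves every finite subset of $G$). The modulus of convexity of a Banach space $\mathcal E$ is $\delta_{\mathcal E}(\varepsilon)=\inf\{1-\lVert\frac{x+y}{2}\rVert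 : \lVert x\rVert=\lVert y\rVert=1,\ \lVert x-y\rVert\ge\varepsilon\}$ for $0<\varepsilon\le 2$. $\mathcal E$ is uniformly convex if $\delta_{\mathcal E}(\varepsilon)>0$ for every such $\varepsilon>0$. $\mathcal E$ is superreflexive if it admits an equivalent uniformly convex norm. A $1$-cocycle for $\pi$ is a map $b\colon G\to\mathcal E$ with $b(gh)=b(g)+\pi(g)b(h)$ for all $g,h\in G$; the space of these is $Z^1(G,\pi)$, with the topology of pointwise norm convergence on $G$. A coboundary is a cocycle of the form $g\mapsto \pi(g)\xi-\xi$ with $\xi\in\mathcal E$; these form the subspace $B^1(G,\pi)$. An almost coboundary is an element of the closure $\overline{B^1(G,\pi)}$ in $Z^1(G,\pi)$, and $H^1_{\mathrm{red}}(G,\pi)=Z^1(G,\pi)/\overline{B^1(G,\pi)}$. *)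

theory Defs
  imports "HOL-Analysis.Analysis" "HOL-Algebra.Elementary_Groups"
begin

subsection \<open>Word metric and controlled Foelner sequences\<close>

definition symmetric_generating_set :: "('g, 'm) monoid_scheme \<Rightarrow> 'g set \<Rightarrow> bool"
  where "symmetric_generating_set G S \<longleftrightarrow>
    S \<subseteq> carrier G \<and> (\<forall>s\<in>S. inv\<^bsub>G\<^esub> s \<in> S) \<and> generate G S = carrier G"

definition word_length :: "('g, 'm) monoid_scheme \<Rightarrow> 'g set \<Rightarrow> 'g \<Rightarrow> nat"
  where "word_length G S g =
    (LEAST n. \<exists>w. set w \<subseteq> S \<and> length w = n \<and> foldr (mult G) w \<one>\<^bsub>G\<^esub> = g)"

definition word_dist :: "('g, 'm) monoid_scheme \<Rightarrow> 'g set \<Rightarrow> 'g \<Rightarrow> 'g \<Rightarrow> nat"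
  where "word_dist G S g h = word_length G S (inv\<^bsub>G\<^esub> g \<otimes>\<^bsub>G\<^esub> h)"

text \<open>Only meaningful for finite non-empty \<^term>\<open>F\<close>.\<close>

definition word_diam :: "('g, 'm) monoid_scheme \<Rightarrow> 'g set \<Rightarrow> 'g set \<Rightarrow> nat"
  where "word_diam G S F = Max ((\<lambda>(g, h). word_dist G S g h) ` (F \<times> F))"

definition cayley_boundary :: "('g, 'm) monoid_scheme \<Rightarrow> 'g set \<Rightarrow> 'g set \<Rightarrow> 'g set"
  where "cayley_boundary G S F = {g \<in> F. \<exists>s\<in>S. g \<otimes>\<^bsub>G\<^esub> s \<notin> F}"

text \<open>Sequences are indexed by the integers \<open>n \<ge> 1\<close>; the value at \<open>0\<close> is irrelevant.\<close>

definition folner_sequence :: "('g, 'm) monoid_scheme \<Rightarrow> 'g set \<Rightarrow> (nat \<Rightarrow> 'g set) \<Rightarrow> bool"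
  where "folner_sequence G S F \<longleftrightarrow>
    (\<forall>n\<ge>1. finite (F n) \<and> F n \<noteq> {} \<and> F n \<subseteq> carrier G) \<and>
    (\<lambda>n. real (card (cayley_boundary G S (F n))) / real (card (F n))) \<longlonglongrightarrow> 0"

text \<open>The bound is written without division by the diameter: since \<open>x / 0 = 0\<close> in HOL, the
  quotient form would force the boundary to be empty when the diameter is \<open>0\<close>.\<close>

definition controlled_folner_sequence ::
    "('g, 'm) monoid_scheme \<Rightarrow> 'g set \<Rightarrow> (nat \<Rightarrow> 'g set) \<Rightarrow> bool"
  where "controlled_folner_sequence G S F \<longleftrightarrow>
    folner_sequence G S F \<and>
    (\<exists>C>0. \<forall>n\<ge>1. real (card (cayley_boundary G S (F n))) * real (word_diam G S (F n))
      \<le> C * real (card (F n)))"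

text \<open>Amenability of a discrete group in the sense of von Neumann: a left-invariant finitely
  additive probability measure on all subsets.\<close>

definition amenable :: "('g, 'm) monoid_scheme \<Rightarrow> bool"
  where "amenable G \<longleftrightarrow> (\<exists>\<mu> :: 'g set \<Rightarrow> real.
    (\<forall>A. A \<subseteq> carrier G \<longrightarrow> 0 \<le> \<mu> A) \<and>
    \<mu> (carrier G) = 1 \<and>
    (\<forall>A B. A \<subseteq> carrier G \<and> B \<subseteq> carrier G \<and> A \<inter> B = {} \<longrightarrow> \<mu> (A \<union> B) = \<mu> A + \<mu> B) \<and>
    (\<forall>g\<in>carrier G. \<forall>A. A \<subseteq> carrier G \<longrightarrow> \<mu> (g <#\<^bsub>G\<^esub> A) = \<mu> A))"


subsection \<open>Superreflexive Banach spaces\<close>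

definition norm_on_type :: "('e::real_vector \<Rightarrow> real) \<Rightarrow> bool"
  where "norm_on_type N \<longleftrightarrow>
    (\<forall>x. 0 \<le> N x) \<and> (\<forall>x. N x = 0 \<longleftrightarrow> x = 0) \<and>
    (\<forall>a x. N (a *\<^sub>R x) = \<bar>a\<bar> * N x) \<and> (\<forall>x y. N (x + y) \<le> N x + N y)"

definition equivalent_norm :: "('e::real_normed_vector \<Rightarrow> real) \<Rightarrow> bool"
  where "equivalent_norm N \<longleftrightarrow>
    norm_on_type N \<and> (\<exists>c>0. \<exists>C>0. \<forall>x. c * norm x \<le> N x \<and> N x \<le> C * norm x)"

text \<open>The infimum is taken in the extended reals, so that it is \<open>\<infinity>\<close> over the empty set;
  this happens only for the zero space, which is uniformly convex.\<close>

definition modulus_of_convexity :: "('e::real_vector \<Rightarrow> real) \<Rightarrow> real \<Rightarrow> ereal"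
  where "modulus_of_convexity N \<epsilon> =
    (INF (x, y) \<in> {(x, y). N x = 1 \<and> N y = 1 \<and> N (x - y) \<ge> \<epsilon>}.
      ereal (1 - N ((1/2) *\<^sub>R (x + y))))"

definition uniformly_convex :: "('e::real_vector \<Rightarrow> real) \<Rightarrow> bool"
  where "uniformly_convex N \<longleftrightarrow> (\<forall>\<epsilon>. 0 < \<epsilon> \<and> \<epsilon> \<le> 2 \<longrightarrow> modulus_of_convexity N \<epsilon> > 0)"

definition superreflexive :: "'e::banach itself \<Rightarrow> bool"
  where "superreflexive (_ :: 'e itself) \<longleftrightarrow>
    (\<exists>N :: 'e \<Rightarrow> real. equivalent_norm N \<and> uniformly_convex N)"


subsection \<open>Representations\<close>

definition bounded_operators :: "('e::real_normed_vector \<Rightarrow>\<^sub>L 'e) monoid"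
  where "bounded_operators = \<lparr>carrier = UNIV, mult = (o\<^sub>L), one = id_blinfun\<rparr>"

definition GL :: "('e::real_normed_vector \<Rightarrow>\<^sub>L 'e) monoid"
  where "GL = units_of bounded_operators"

definition group_representation :: "('g, 'm) monoid_scheme \<Rightarrow> ('g \<Rightarrow> 'e::banach \<Rightarrow>\<^sub>L 'e) \<Rightarrow> bool"
  where "group_representation G \<pi> \<longleftrightarrow> \<pi> \<in> hom G GL"

definition uniformly_bounded_rep :: "('g, 'm) monoid_scheme \<Rightarrow> ('g \<Rightarrow> 'e::banach \<Rightarrow>\<^sub>L 'e) \<Rightarrow> bool"
  where "uniformly_bounded_rep G \<pi> \<longleftrightarrow> (\<exists>C>0. \<forall>g\<in>carrier G. norm (\<pi> g) \<le> C)"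

text \<open>The filter is that of \<open>g \<rightarrow> \<infinity>\<close> in \<^term>\<open>carrier G\<close>, generated by complements of finite sets.\<close>

definition c0_rep :: "('g, 'm) monoid_scheme \<Rightarrow> ('g \<Rightarrow> 'e::banach \<Rightarrow>\<^sub>L 'e) \<Rightarrow> bool"
  where "c0_rep G \<pi> \<longleftrightarrow> (\<forall>\<xi>. \<forall>\<phi> :: 'e \<Rightarrow>\<^sub>L real.
    ((\<lambda>g. blinfun_apply \<phi> (blinfun_apply (\<pi> g) \<xi>)) \<longlongrightarrow> 0)
      (inf cofinite (principal (carrier G))))"


subsection \<open>First reduced cohomology\<close>

text \<open>Maps on \<^term>\<open>carrier G\<close> are represented by extensional functions (\<^const>\<open>undefined\<close> outside),
  matching the points of \<^const>\<open>product_topology\<close>.\<close>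

definition cocycles :: "('g, 'm) monoid_scheme \<Rightarrow> ('g \<Rightarrow> 'e::banach \<Rightarrow>\<^sub>L 'e) \<Rightarrow> ('g \<Rightarrow> 'e) set"
  where "cocycles G \<pi> = {b \<in> extensional (carrier G).
    \<forall>g\<in>carrier G. \<forall>h\<in>carrier G. b (g \<otimes>\<^bsub>G\<^esub> h) = b g + blinfun_apply (\<pi> g) (b h)}"

definition coboundaries :: "('g, 'm) monoid_scheme \<Rightarrow> ('g \<Rightarrow> 'e::banach \<Rightarrow>\<^sub>L 'e) \<Rightarrow> ('g \<Rightarrow> 'e) set"
  where "coboundaries G \<pi> = range (\<lambda>\<xi>. \<lambda>g\<in>carrier G. blinfun_apply (\<pi> g) \<xi> - \<xi>)"

definition cocycle_topology ::
    "('g, 'm) monoid_scheme \<Rightarrow> ('g \<Rightarrow> 'e::banach \<Rightarrow>\<^sub>L 'e) \<Rightarrow> ('g \<Rightarrow> 'e) topology"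
  where "cocycle_topology G \<pi> =
    subtopology (product_topology (\<lambda>_. euclidean) (carrier G)) (cocycles G \<pi>)"

definition almost_coboundaries ::
    "('g, 'm) monoid_scheme \<Rightarrow> ('g \<Rightarrow> 'e::banach \<Rightarrow>\<^sub>L 'e) \<Rightarrow> ('g \<Rightarrow> 'e) set"
  where "almost_coboundaries G \<pi> = cocycle_topology G \<pi> closure_of coboundaries G \<pi>"

definition cocycle_group ::
    "('g, 'm) monoid_scheme \<Rightarrow> ('g \<Rightarrow> 'e::banach \<Rightarrow>\<^sub>L 'e) \<Rightarrow> ('g \<Rightarrow> 'e) monoid"
  where "cocycle_group G \<pi> =
    \<lparr>carrier = cocycles G \<pi>,
     mult = (\<lambda>b c. \<lambda>g\<in>carrier G. b g + c g),
     one = (\<lambda>g\<in>carrier G. 0)\<rparr>"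

text \<open>The quotient is formed in the category of abelian groups; the scalar action plays no role
  in its vanishing.\<close>

definition H1_red ::
    "('g, 'm) monoid_scheme \<Rightarrow> ('g \<Rightarrow> 'e::banach \<Rightarrow>\<^sub>L 'e) \<Rightarrow> ('g \<Rightarrow> 'e) set monoid"
  where "H1_red G \<pi> = cocycle_group G \<pi> Mod almost_coboundaries G \<pi>"

end

theory Submission
  imports Defs
begin

text \<open>Renorming \<open>\<E>\<close> by the supremum of a uniformly convex norm over the orbit, one may assume
  that \<open>\<pi>\<close> is isometric and the norm uniformly convex. Since \<open>\<pi>\<close> is \<open>c\<^sub>0\<close>, every cocycle then
  grows sublinearly in word length. The average of \<open>b\<close> over the inverse of a Foelner set \<open>F\<close> is
  fixed by the affine action \<open>\<xi> \<mapsto> \<pi> s \<xi> + b s\<close> up to an error of order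
  \<open>(|\<partial>F| / |F|) * max {\<parallel>b g\<parallel> : |g| \<le> diam F + 1}\<close>, which tends to \<open>0\<close> by sublinearity and the
  control on \<open>|\<partial>F|\<close>; so \<open>b\<close> is a limit of coboundaries.\<close>

subsection \<open>Norming functionals\<close>

text \<open>The \<open>c0\<close> hypothesis concerns scalars, the conclusion concerns norms. A
  functional norming \<open>x\<close> bridges the two: \<open>P (x - \<pi> w y)\<close> is at least
  \<open>P x\<close> minus its value at \<open>\<pi> w y\<close>, so only finitely many translates
  of \<open>y\<close> come close to \<open>x\<close>. Against this, uniform convexity produces close
  translates whenever growth is linear, since two vectors of norm at most \<open>R\<close> whose sum
  has norm nearly \<open>2 * R\<close> are close to each other. Sublinear growth is just what the
  averaging needs. A bound \<open>\<epsilon> * |g| + K\<close> leaves an error of order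
  \<open>\<epsilon> * C + K * |\<partial>F| / |F|\<close> up to small terms: the control makes the
  first summand small for all sets of the sequence at once, and the Foelner condition removes the
  second once \<open>K\<close> is fixed. Linear growth would only give a bounded error.\<close>

definition sublinear :: "('e::real_vector \<Rightarrow> real) \<Rightarrow> bool"
  where "sublinear q \<longleftrightarrow>
    (\<forall>x y. q (x + y) \<le> q x + q y) \<and> (\<forall>a>0. \<forall>x. q (a *\<^sub>R x) \<le> a * q x)"

lemma sublinear_add: "sublinear q \<Longrightarrow> q (x + y) \<le> q x + q y"
  by (simp add: sublinear_def)

text \<open>\<open>sublinear\<close> asks only for an inequality, which is all that the infimum
  constructions then have to supply; using it for both \<open>a\<close> and \<open>1 / a\<close>
  gives equality.\<close>

lemma sublinear_scaleR:
  assumes "sublinear q" and "0 < a"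
  shows "q (a *\<^sub>R x) = a * q x"
proof (rule antisym)
  show "q (a *\<^sub>R x) \<le> a * q x"
    using assms by (simp add: sublinear_def)
  have "q ((1 / a) *\<^sub>R a *\<^sub>R x) \<le> (1 / a) * q (a *\<^sub>R x)"
    using assms unfolding sublinear_def by (metis zero_less_divide_1_iff)
  then show "a * q x \<le> q (a *\<^sub>R x)"
    using assms(2) by (simp add: field_simps)
qed

lemma sublinear_zero: "sublinear q \<Longrightarrow> q 0 = 0"
  using sublinear_scaleR[of q 2 0] by simp

lemma sublinear_lower_bound:
  assumes "sublinear q"
  shows "- q (- x) \<le> q x"
  using sublinear_add[OF assms, of x "- x"] sublinear_zero[OF assms] by simp

text \<open>A sublinear functional minimal below \<open>p\<close> is unchanged by the following operation, hence
  additive; applying the operation to \<open>p\<close> itself first forces the minimal functional to agree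
  with \<open>p\<close> at the chosen point.\<close>

definition linearize_at :: "('e::real_vector \<Rightarrow> real) \<Rightarrow> 'e \<Rightarrow> 'e \<Rightarrow> real"
  where "linearize_at q y x = (INF t\<in>{0..}. q (x + t *\<^sub>R y) - t * q y)"

lemma linearize_at_le:
  assumes "sublinear q" and "0 \<le> t"
  shows "linearize_at q y x \<le> q (x + t *\<^sub>R y) - t * q y"
  unfolding linearize_at_def
proof (rule cINF_lower)
  \<comment> \<open>A lower bound independent of \<open>s\<close>, from
    \<open>s * q y = q (s *\<^sub>R y)\<close> and subadditivity, so that the real infimum is a
    genuine one.\<close>
  have "- q (- x) \<le> q (x + s *\<^sub>R y) - s * q y" if "0 \<le> s" for s
  proof -
    have "q (s *\<^sub>R y) = s * q y"
      using that sublinear_scaleR[OF assms(1)] sublinear_zero[OF assms(1)] by (cases "s = 0") auto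
    then show ?thesis
      using sublinear_add[OF assms(1), of "x + s *\<^sub>R y" "- x"] by simp
  qed
  then show "bdd_below ((\<lambda>t. q (x + t *\<^sub>R y) - t * q y) ` {0..})"
    by (intro bdd_belowI2) auto
qed (use assms in auto)

lemma linearize_at_greatest:
  assumes "\<And>t. 0 \<le> t \<Longrightarrow> c \<le> q (x + t *\<^sub>R y) - t * q y"
  shows "c \<le> linearize_at q y x"
  unfolding linearize_at_def using assms by (intro cINF_greatest) auto

lemma sublinear_linearize_at:
  assumes "sublinear q"
  shows "sublinear (linearize_at q y)"
  unfolding sublinear_def
proof (intro conjI allI impI)
  fix u v
  have "linearize_at q y (u + v) - (q (u + t *\<^sub>R y) - t * q y) \<le> linearize_at q y v"
    if t: "0 \<le> t" for t
  proof (rule linearize_at_greatest)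
    fix s :: real assume s: "0 \<le> s"
    have "linearize_at q y (u + v) \<le> q ((u + v) + (t + s) *\<^sub>R y) - (t + s) * q y"
      using s t by (intro linearize_at_le assms) auto
    also have "(u + v) + (t + s) *\<^sub>R y = (u + t *\<^sub>R y) + (v + s *\<^sub>R y)"
      by (simp add: algebra_simps)
    finally show "linearize_at q y (u + v) - (q (u + t *\<^sub>R y) - t * q y)
        \<le> q (v + s *\<^sub>R y) - s * q y"
      using sublinear_add[OF assms, of "u + t *\<^sub>R y" "v + s *\<^sub>R y"]
      by (simp add: algebra_simps)
  qed
  then have "linearize_at q y (u + v) - linearize_at q y v \<le> linearize_at q y u"
    by (intro linearize_at_greatest) (simp add: algebra_simps)
  then show "linearize_at q y (u + v) \<le> linearize_at q y u + linearize_at q y v"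
    by simp
next
  fix a :: real and x assume a: "0 < a"
  have "linearize_at q y (a *\<^sub>R x) / a \<le> linearize_at q y x"
  proof (rule linearize_at_greatest)
    fix t :: real assume t: "0 \<le> t"
    have "linearize_at q y (a *\<^sub>R x) \<le> q (a *\<^sub>R x + (a * t) *\<^sub>R y) - (a * t) * q y"
      using a t by (intro linearize_at_le assms) auto
    also have "a *\<^sub>R x + (a * t) *\<^sub>R y = a *\<^sub>R (x + t *\<^sub>R y)"
      by (simp add: algebra_simps)
    also have "q \<dots> = a * q (x + t *\<^sub>R y)"
      by (rule sublinear_scaleR[OF assms a])
    finally show "linearize_at q y (a *\<^sub>R x) / a \<le> q (x + t *\<^sub>R y) - t * q y"
      using a by (simp add: field_simps)
  qed
  then show "linearize_at q y (a *\<^sub>R x) \<le> a * linearize_at q y x"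
    using a by (simp add: field_simps)
qed

text \<open>Infima need not preserve subadditivity. In a chain, the smaller of \<open>q\<close> and
  \<open>r\<close> can be used at both \<open>x\<close> and \<open>y\<close>. The common majorant
  \<open>p\<close> gives the lower bound \<open>- p (- x)\<close> that keeps the infimum
  finite.\<close>

lemma sublinear_INF_chain:
  fixes C :: "('e::real_vector \<Rightarrow> real) set"
  assumes "C \<noteq> {}" and "\<And>q. q \<in> C \<Longrightarrow> sublinear q \<and> q \<le> p"
    and chain: "\<And>q r. q \<in> C \<Longrightarrow> r \<in> C \<Longrightarrow> q \<le> r \<or> r \<le> q"
  shows "sublinear (\<lambda>x. INF q\<in>C. q x)" and "\<And>q x. q \<in> C \<Longrightarrow> (INF q\<in>C. q x) \<le> q x"
proof -
  have "- p (- x) \<le> q x" if "q \<in> C" for q x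
    using assms(2)[OF that] sublinear_lower_bound[of q x] le_funD[of q p "- x"] by linarith
  then have "bdd_below ((\<lambda>q. q x) ` C)" for x
    by (intro bdd_belowI2)
  then show lower: "\<And>q x. q \<in> C \<Longrightarrow> (INF q\<in>C. q x) \<le> q x"
    by (rule cINF_lower)
  show "sublinear (\<lambda>x. INF q\<in>C. q x)"
    unfolding sublinear_def
  proof (intro conjI allI impI)
    fix x y
    have "(INF q\<in>C. q (x + y)) \<le> q x + r y" if q: "q \<in> C" and r: "r \<in> C" for q r
    proof -
      obtain m where m: "m \<in> C" "m \<le> q" "m \<le> r"
        using chain[OF q r] q r by blast
      have "(INF q\<in>C. q (x + y)) \<le> m x + m y"
        using lower[OF m(1), of "x + y"] sublinear_add[of m x y] assms(2)[OF m(1)] by linarith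
      then show ?thesis
        using le_funD[OF m(2), of x] le_funD[OF m(3), of y] by linarith
    qed
    then have "(INF q\<in>C. q (x + y)) - r y \<le> (INF q\<in>C. q x)" if "r \<in> C" for r
      using that by (intro cINF_greatest assms(1)) (simp add: algebra_simps)
    then have "(INF q\<in>C. q (x + y)) - (INF q\<in>C. q x) \<le> (INF q\<in>C. q y)"
      by (intro cINF_greatest assms(1)) (simp add: algebra_simps)
    then show "(INF q\<in>C. q (x + y)) \<le> (INF q\<in>C. q x) + (INF q\<in>C. q y)"
      by simp
  next
    fix a :: real and x assume a: "0 < a"
    have "(INF q\<in>C. q (a *\<^sub>R x)) / a \<le> (INF q\<in>C. q x)"
    proof (rule cINF_greatest[OF assms(1)])
      fix q assume q: "q \<in> C"
      show "(INF q\<in>C. q (a *\<^sub>R x)) / a \<le> q x"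
        using lower[OF q, of "a *\<^sub>R x"] sublinear_scaleR[of q a x] assms(2)[OF q] a
        by (simp add: field_simps)
    qed
    then show "(INF q\<in>C. q (a *\<^sub>R x)) \<le> a * (INF q\<in>C. q x)"
      using a by (simp add: field_simps)
  qed
qed

lemma minimal_sublinear_exists:
  assumes "sublinear p"
  obtains m where "sublinear m" "m \<le> p" "\<And>q. sublinear q \<Longrightarrow> q \<le> m \<Longrightarrow> q = m"
proof -
  let ?A = "{q. sublinear q \<and> q \<le> p}"
  have "\<exists>m\<in>?A. \<forall>q\<in>?A. q \<le> m \<longrightarrow> q = m"
  proof (rule predicate_Zorn)
    \<comment> \<open>The order is reversed, so the maximal element supplied by Zorn's lemma is a
      minimal functional.\<close>
    show "partial_order_on ?A (relation_of (\<lambda>x y. y \<le> x) ?A)"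
      by (rule partial_order_on_relation_ofI) auto
    fix C assume "C \<in> Chains (relation_of (\<lambda>x y. y \<le> x) ?A)"
    then have C: "\<And>q. q \<in> C \<Longrightarrow> sublinear q \<and> q \<le> p"
      and chain: "\<And>q r. q \<in> C \<Longrightarrow> r \<in> C \<Longrightarrow> q \<le> r \<or> r \<le> q"
      unfolding Chains_def relation_of_def by blast+
    show "\<exists>u\<in>?A. \<forall>q\<in>C. u \<le> q"
    proof (cases "C = {}")
      case True
      then show ?thesis using assms by auto
    next
      case False
      have below: "(\<lambda>x. INF q\<in>C. q x) \<le> q" if "q \<in> C" for q
        by (intro le_funI sublinear_INF_chain(2)[where p = p]) (use False C chain that in auto)
      moreover obtain q0 where "q0 \<in> C"
        using False by blast
      ultimately have "(\<lambda>x. INF q\<in>C. q x) \<le> p"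
        using C order_trans by blast
      moreover have "sublinear (\<lambda>x. INF q\<in>C. q x)"
        by (intro sublinear_INF_chain(1)[where p = p]) (use False C chain in auto)
      ultimately show ?thesis
        using below by blast
    qed
  qed
  then show ?thesis
    using that order_trans by blast
qed

lemma linear_minimal_sublinear:
  assumes m: "sublinear m" and min: "\<And>q. sublinear q \<Longrightarrow> q \<le> m \<Longrightarrow> q = m"
  shows "linear m"
proof -
  have "m x + m y \<le> m (x + y)" for x y
  proof -
    \<comment> \<open>The value \<open>t = 0\<close> puts the linearization below \<open>m\<close>;
      once the two agree, \<open>t = 1\<close> gives the reverse of subadditivity.\<close>
    have "linearize_at m y \<le> m"
      using linearize_at_le[OF m, of 0 y] by (intro le_funI) simp
    then have "linearize_at m y = m"
      by (intro min sublinear_linearize_at m)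
    then show ?thesis
      using linearize_at_le[OF m, of 1 y x] by simp
  qed
  then have add: "m (x + y) = m x + m y" for x y
    using sublinear_add[OF m] by (intro antisym)
  have neg: "m (- x) = - m x" for x
    using add[of x "- x"] sublinear_zero[OF m] by simp
  have "m (a *\<^sub>R x) = a *\<^sub>R m x" for a x
    using sublinear_scaleR[OF m, of a x] sublinear_scaleR[OF m, of "- a" x] neg[of "a *\<^sub>R x"]
      sublinear_zero[OF m]
    by (cases "a = 0"; cases "0 < a") auto
  then show ?thesis
    using add by (intro linearI)
qed

text \<open>Hahn-Banach in supporting form. Choosing \<open>f\<close> below
  \<open>linearize_at p x0\<close> instead of \<open>p\<close> yields
  \<open>f (- x0) \<le> - p x0\<close> (take \<open>t = 1\<close>), and linearity turns this into
  \<open>f x0 \<ge> p x0\<close>.\<close>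

theorem norming_functional_exists:
  assumes "sublinear p"
  obtains f where "linear f" "\<And>x. f x \<le> p x" "f x0 = p x0"
proof -
  obtain f where f: "sublinear f" "f \<le> linearize_at p x0" "\<And>q. sublinear q \<Longrightarrow> q \<le> f \<Longrightarrow> q = f"
    using minimal_sublinear_exists[OF sublinear_linearize_at[OF assms]] by blast
  have lin: "linear f"
    using f by (intro linear_minimal_sublinear)
  have le: "f x \<le> p x" for x
    using le_funD[OF f(2), of x] linearize_at_le[OF assms, of 0 x0 x] by simp
  have "f (- x0) \<le> - p x0"
    using le_funD[OF f(2), of "- x0"] linearize_at_le[OF assms, of 1 x0 "- x0"]
      sublinear_zero[OF assms] by simp
  then have "f x0 = p x0"
    using le[of x0] linear_neg[OF lin, of x0] by simp
  with lin le show ?thesis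
    using that by blast
qed

subsection \<open>Uniformly convex norms\<close>

lemma
  assumes "norm_on_type N"
  shows norm_on_type_nonneg: "0 \<le> N x"
    and norm_on_type_eq_0: "N x = 0 \<longleftrightarrow> x = 0"
    and norm_on_type_scaleR: "N (a *\<^sub>R x) = \<bar>a\<bar> * N x"
    and norm_on_type_triangle: "N (x + y) \<le> N x + N y"
  using assms by (auto simp: norm_on_type_def)

lemma norm_on_type_zero: "norm_on_type N \<Longrightarrow> N 0 = 0"
  by (simp add: norm_on_type_eq_0)

lemma norm_on_type_minus: "norm_on_type N \<Longrightarrow> N (- x) = N x"
  using norm_on_type_scaleR[of N "-1" x] by simp

lemma norm_on_type_diff: "norm_on_type N \<Longrightarrow> N (x - y) \<le> N x + N y"
  using norm_on_type_triangle[of N x "- y"] norm_on_type_minus[of N y] by simp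

lemma norm_on_type_sum:
  assumes "norm_on_type N"
  shows "N (sum f A) \<le> (\<Sum>a\<in>A. N (f a))"
proof (induction A rule: infinite_finite_induct)
  case (insert a A)
  then show ?case
    using norm_on_type_triangle[OF assms, of "f a" "sum f A"] by simp
qed (simp_all add: norm_on_type_zero[OF assms])

lemma sublinear_norm_on_type: "norm_on_type N \<Longrightarrow> sublinear N"
  by (simp add: sublinear_def norm_on_type_def)

lemma uniformly_convex_sphere:
  assumes "uniformly_convex N" and "0 < \<epsilon>" "\<epsilon> \<le> 2"
  obtains \<delta> where "0 < \<delta>"
    "\<And>x y. N x = 1 \<Longrightarrow> N y = 1 \<Longrightarrow> \<epsilon> \<le> N (x - y) \<Longrightarrow> N ((1/2) *\<^sub>R (x + y)) \<le> 1 - \<delta>"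
proof -
  have "0 < modulus_of_convexity N \<epsilon>"
    using assms by (simp add: uniformly_convex_def)
  \<comment> \<open>A real number strictly below the modulus, because the modulus itself is infinite
    on the zero space.\<close>
  then obtain d where d: "0 < ereal d" "ereal d < modulus_of_convexity N \<epsilon>"
    using ereal_dense2 by blast
  show ?thesis
  proof (rule that[of d])
    show "0 < d" using d by simp
    fix x y assume "N x = 1" "N y = 1" "\<epsilon> \<le> N (x - y)"
    then have "modulus_of_convexity N \<epsilon> \<le> ereal (1 - N ((1/2) *\<^sub>R (x + y)))"
      unfolding modulus_of_convexity_def by (intro INF_lower2[of "(x, y)"]) auto
    with d(2) have "ereal d < ereal (1 - N ((1/2) *\<^sub>R (x + y)))"
      by (rule less_le_trans)
    then show "N ((1/2) *\<^sub>R (x + y)) \<le> 1 - d" by simp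
  qed
qed

text \<open>Let \<open>x\<close> be the shorter vector. If
  \<open>N x \<le> 1 - \<epsilon>/4\<close>, the triangle inequality gains
  \<open>\<epsilon>/8\<close>. Otherwise normalizing both vectors costs at most
  \<open>\<epsilon>/2\<close> of their separation, so the sphere estimate for
  \<open>\<epsilon>/2\<close> applies; its gain \<open>d\<close> is scaled by
  \<open>N x \<ge> 1/2\<close>, whence \<open>d/2\<close>.\<close>

lemma uniformly_convex_ball:
  assumes N: "norm_on_type N" and uc: "uniformly_convex N" and "0 < \<epsilon>"
  obtains \<delta> where "0 < \<delta>"
    "\<And>x y. N x \<le> 1 \<Longrightarrow> N y \<le> 1 \<Longrightarrow> \<epsilon> \<le> N (x - y) \<Longrightarrow> N ((1/2) *\<^sub>R (x + y)) \<le> 1 - \<delta>"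
proof (cases "\<epsilon> \<le> 2")
  case False
  then have False if "N x \<le> 1" "N y \<le> 1" "\<epsilon> \<le> N (x - y)" for x y
    using norm_on_type_diff[OF N, of x y] that by simp
  then show ?thesis using that[of 1] by force
next
  case True
  obtain d where d: "0 < d"
    "\<And>x y. N x = 1 \<Longrightarrow> N y = 1 \<Longrightarrow> \<epsilon>/2 \<le> N (x - y) \<Longrightarrow> N ((1/2) *\<^sub>R (x + y)) \<le> 1 - d"
    using uniformly_convex_sphere[OF uc, of "\<epsilon>/2"] True \<open>0 < \<epsilon>\<close> by auto
  have half: "N ((1/2) *\<^sub>R z) = N z / 2" for z
    using norm_on_type_scaleR[OF N, of "1/2" z] by simp
  have key: "N ((1/2) *\<^sub>R (x + y)) \<le> 1 - min (\<epsilon>/8) (d/2)"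
    if x: "N x \<le> 1" and y: "N y \<le> 1" and xy: "\<epsilon> \<le> N (x - y)" and le: "N x \<le> N y" for x y
  proof (cases "N x \<le> 1 - \<epsilon>/4")
    case True
    then have "N (x + y) / 2 \<le> 1 - \<epsilon>/8"
      using norm_on_type_triangle[OF N, of x y] y by (simp add: field_simps)
    then show ?thesis by (simp add: half)
  next
    case False
    let ?a = "N x" and ?b = "N y"
    have a: "1/2 \<le> ?a" "1 - \<epsilon>/4 < ?a" and b: "1/2 \<le> ?b" "1 - \<epsilon>/4 < ?b"
      using False le True by auto
    define u v where "u = (1 / ?a) *\<^sub>R x" and "v = (1 / ?b) *\<^sub>R y"
    have xu: "x = ?a *\<^sub>R u" and yv: "y = ?b *\<^sub>R v"
      using a b by (auto simp: u_def v_def)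
    have u: "N u = 1" and v: "N v = 1"
      using a b by (auto simp: u_def v_def norm_on_type_scaleR[OF N])
    have "x - y = (u - v) + ((?b - 1) *\<^sub>R (- v) + (?a - 1) *\<^sub>R u)"
      by (subst xu, subst yv) (simp add: algebra_simps)
    then have "N (x - y) \<le> N (u - v) + (N ((?b - 1) *\<^sub>R (- v)) + N ((?a - 1) *\<^sub>R u))"
      using norm_on_type_triangle[OF N] by (metis add_left_mono order_trans)
    also have "\<dots> = N (u - v) + ((1 - ?b) + (1 - ?a))"
      using x y u v by (simp only: norm_on_type_scaleR[OF N] norm_on_type_minus[OF N]) simp
    finally have "\<epsilon>/2 \<le> N (u - v)"
      using xy a b by simp
    then have uv: "N (u + v) \<le> 2 * (1 - d)"
      using d(2)[OF u v] by (simp add: half)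
    have "x + y = ?a *\<^sub>R (u + v) + (?b - ?a) *\<^sub>R v"
      by (subst xu, subst yv) (simp add: algebra_simps)
    then have "N (x + y) \<le> N (?a *\<^sub>R (u + v)) + N ((?b - ?a) *\<^sub>R v)"
      using norm_on_type_triangle[OF N] by metis
    also have "\<dots> = ?a * N (u + v) + (?b - ?a)"
      using a le v by (simp add: norm_on_type_scaleR[OF N])
    also have "\<dots> \<le> ?a * (2 * (1 - d)) + (?b - ?a)"
      using uv a by (intro add_right_mono mult_left_mono) auto
    also have "\<dots> = ?a + ?b - 2 * ?a * d"
      by (simp add: algebra_simps)
    also have "\<dots> \<le> 2 - d"
    proof -
      have "1 * d \<le> (2 * ?a) * d"
        using a d(1) by (intro mult_right_mono) auto
      then show ?thesis using x y by simp
    qed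
    finally show ?thesis by (simp add: half)
  qed
  show ?thesis
  proof (rule that[of "min (\<epsilon>/8) (d/2)"])
    show "0 < min (\<epsilon>/8) (d/2)" using d \<open>0 < \<epsilon>\<close> by simp
    fix x y assume *: "N x \<le> 1" "N y \<le> 1" "\<epsilon> \<le> N (x - y)"
    have "N (y - x) = N (x - y)"
      using norm_on_type_minus[OF N, of "x - y"] by simp
    then show "N ((1/2) *\<^sub>R (x + y)) \<le> 1 - min (\<epsilon>/8) (d/2)"
      using key[of x y] key[of y x] * by (cases "N x \<le> N y") (auto simp: add.commute)
  qed
qed

subsection \<open>Word length\<close>

locale word_group = group G for G :: "('g, 'm) monoid_scheme" (structure) +
  fixes S :: "'g set"
  assumes finite_gens: "finite S" and sym_gen: "symmetric_generating_set G S"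
begin

abbreviation len :: "'g \<Rightarrow> nat"
  where "len \<equiv> word_length G S"

abbreviation word_prod :: "'g list \<Rightarrow> 'g"
  where "word_prod w \<equiv> foldr (mult G) w \<one>"

lemma gens_closed: "S \<subseteq> carrier G"
  and gens_inv: "s \<in> S \<Longrightarrow> inv s \<in> S"
  and gens_generate: "generate G S = carrier G"
  using sym_gen by (auto simp: symmetric_generating_set_def)

lemma word_prod_closed: "set w \<subseteq> S \<Longrightarrow> word_prod w \<in> carrier G"
  using gens_closed by (induction w) auto

lemma word_prod_append:
  "set v \<subseteq> S \<Longrightarrow> set w \<subseteq> S \<Longrightarrow> word_prod (v @ w) = word_prod v \<otimes> word_prod w"
proof (induction v)
  case (Cons s v)
  then show ?case
    using gens_closed word_prod_closed[of v] word_prod_closed[of w] by (auto simp: m_assoc)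
qed (simp add: word_prod_closed)

lemma word_exists:
  assumes "g \<in> carrier G"
  shows "\<exists>w. set w \<subseteq> S \<and> word_prod w = g"
proof -
  have "g \<in> generate G S" using assms gens_generate by simp
  then show ?thesis
  proof (induction rule: generate.induct)
    case one
    show ?case by (rule exI[of _ "[]"]) simp
  next
    case (incl s)
    then show ?case using gens_closed by (intro exI[of _ "[s]"]) auto
  next
    case (inv s)
    then show ?case using gens_closed gens_inv by (intro exI[of _ "[inv s]"]) auto
  next
    case (eng g h)
    then obtain v w where "set v \<subseteq> S" "word_prod v = g" "set w \<subseteq> S" "word_prod w = h"
      by blast
    then show ?case using word_prod_append by (intro exI[of _ "v @ w"]) auto
  qed
qed

lemma geodesic_word:
  assumes "g \<in> carrier G"
  obtains w where "set w \<subseteq> S" "length w = len g" "word_prod w = g"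
proof -
  have "\<exists>n w. set w \<subseteq> S \<and> length w = n \<and> word_prod w = g"
    using word_exists[OF assms] by blast
  from LeastI_ex[OF this] show ?thesis
    using that unfolding word_length_def by blast
qed

lemma len_word_prod: "set w \<subseteq> S \<Longrightarrow> len (word_prod w) \<le> length w"
  unfolding word_length_def by (rule Least_le) blast

text \<open>Only an inequality, since \<open>S\<close> may contain the identity, whose length is
  0.\<close>

lemma len_gen: "s \<in> S \<Longrightarrow> len s \<le> 1"
  using len_word_prod[of "[s]"] gens_closed by auto

lemma len_mult:
  assumes "g \<in> carrier G" "h \<in> carrier G"
  shows "len (g \<otimes> h) \<le> len g + len h"
proof -
  obtain v where "set v \<subseteq> S" "length v = len g" "word_prod v = g"
    using geodesic_word[OF assms(1)] .
  moreover obtain w where "set w \<subseteq> S" "length w = len h" "word_prod w = h"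
    using geodesic_word[OF assms(2)] .
  ultimately show ?thesis
    using len_word_prod[of "v @ w"] word_prod_append[of v w] by simp
qed

lemma finite_len_ball: "finite {g \<in> carrier G. len g \<le> n}"
proof (rule finite_subset)
  show "{g \<in> carrier G. len g \<le> n} \<subseteq> word_prod ` {w. set w \<subseteq> S \<and> length w \<le> n}"
    by (auto elim: geodesic_word)
  show "finite (word_prod ` {w. set w \<subseteq> S \<and> length w \<le> n})"
    using finite_gens by (intro finite_imageI finite_lists_length_le)
qed

text \<open>The points are the prefixes of a geodesic word. Subwords bound the distances from above;
  a shorter connection between two prefixes would shorten the word for \<open>g\<close>.\<close>

lemma geodesic_path:
  assumes g: "g \<in> carrier G"
  obtains x where "\<And>i. x i \<in> carrier G" "x 0 = \<one>" "x (len g) = g"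
    "\<And>i j. i \<le> j \<Longrightarrow> j \<le> len g \<Longrightarrow> len (inv (x i) \<otimes> x j) = j - i"
proof -
  obtain w where w: "set w \<subseteq> S" "length w = len g" "word_prod w = g"
    using geodesic_word[OF g] .
  define x where "x i = word_prod (take i w)" for i
  have sub: "set (take i w) \<subseteq> S" "set (drop i w) \<subseteq> S" for i
    using w(1) set_take_subset set_drop_subset by fast+
  have x: "x i \<in> carrier G" for i
    unfolding x_def by (intro word_prod_closed sub)
  have le: "len (inv (x i) \<otimes> x j) \<le> j - i" if "i \<le> j" for i j
  proof -
    have "take j w = take i w @ drop i (take j w)"
      using that by (metis append_take_drop_id min.absorb1 take_take)
    moreover have "set (drop i (take j w)) \<subseteq> S"
      using sub(1)[of j] set_drop_subset by fast
    ultimately have "x j = x i \<otimes> word_prod (drop i (take j w))"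
      and "word_prod (drop i (take j w)) \<in> carrier G"
      and "len (word_prod (drop i (take j w))) \<le> length (drop i (take j w))"
      unfolding x_def using word_prod_append[OF sub(1)] word_prod_closed len_word_prod by metis+
    then show ?thesis
      using x[of i] by (simp add: m_assoc[symmetric])
  qed
  have x0: "x 0 = \<one>" and xn: "x (len g) = g"
    using w by (simp_all add: x_def)
  have "len (inv (x i) \<otimes> x j) = j - i" if ij: "i \<le> j" "j \<le> len g" for i j
  proof -
    have cancel: "x k \<otimes> (inv (x k) \<otimes> h) = h" if "h \<in> carrier G" for k h
      using x that by (simp add: m_assoc[symmetric])
    have "g = (inv (x 0) \<otimes> x i) \<otimes> ((inv (x i) \<otimes> x j) \<otimes> (inv (x j) \<otimes> x (len g)))"
      using x g by (simp add: x0 xn m_assoc cancel)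
    then have "len g \<le> len (inv (x 0) \<otimes> x i) + len ((inv (x i) \<otimes> x j) \<otimes> (inv (x j) \<otimes> x (len g)))"
      using len_mult x by (metis inv_closed m_closed)
    also have "\<dots> \<le> len (inv (x 0) \<otimes> x i) + (len (inv (x i) \<otimes> x j) + len (inv (x j) \<otimes> x (len g)))"
      using x by (intro add_left_mono len_mult) auto
    also have "\<dots> \<le> (i - 0) + (len (inv (x i) \<otimes> x j) + (len g - j))"
      using ij by (intro add_mono le order_refl) auto
    finally show ?thesis
      using le[OF ij(1)] ij by linarith
  qed
  with x x0 xn show ?thesis using that by blast
qed

end

subsection \<open>Sublinear growth of cocycles\<close>

lemma sum_lessThan_add:
  fixes v :: "nat \<Rightarrow> 'b::comm_monoid_add"
  shows "(\<Sum>i<k + j. v i) = (\<Sum>i<k. v i) + (\<Sum>i<j. v (i + k))"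
  by (induction j) (simp_all add: ac_simps)

locale isometric_rep = word_group G S
  for G :: "('g, 'm) monoid_scheme" (structure) and S :: "'g set" +
  fixes \<pi> :: "'g \<Rightarrow> 'e::banach \<Rightarrow>\<^sub>L 'e" and P :: "'e \<Rightarrow> real"
  assumes rep_one: "\<pi> \<one> x = x"
    and rep_mult: "g \<in> carrier G \<Longrightarrow> h \<in> carrier G \<Longrightarrow> \<pi> (g \<otimes> h) x = \<pi> g (\<pi> h x)"
    and P_norm: "norm_on_type P"
    and P_rep: "g \<in> carrier G \<Longrightarrow> P (\<pi> g x) = P x"
begin

text \<open>Unlike \<open>cocycles\<close>, this does not ask for extensionality, so
  \<open>coboundary_defect\<close> below is a cocycle without being restricted to the
  carrier.\<close>

definition cocycle :: "('g \<Rightarrow> 'e) \<Rightarrow> bool"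
  where "cocycle b \<longleftrightarrow> (\<forall>g\<in>carrier G. \<forall>h\<in>carrier G. b (g \<otimes> h) = b g + \<pi> g (b h))"

lemma cocycleD:
  "cocycle b \<Longrightarrow> g \<in> carrier G \<Longrightarrow> h \<in> carrier G \<Longrightarrow> b (g \<otimes> h) = b g + \<pi> g (b h)"
  by (simp add: cocycle_def)

lemma cocycle_one: "cocycle b \<Longrightarrow> b \<one> = 0"
  using cocycleD[of b \<one> \<one>] rep_one by simp

text \<open>With invariance of \<open>P\<close>, the size of an increment depends only on
  \<open>inv g \<otimes> h\<close>.\<close>

lemma cocycle_diff:
  assumes "cocycle b" "g \<in> carrier G" "h \<in> carrier G"
  shows "b h - b g = \<pi> g (b (inv g \<otimes> h))"
  using cocycleD[OF assms(1), of g "inv g \<otimes> h"] assms by (simp add: m_assoc[symmetric])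

text \<open>Used twice: it makes the optimal growth rate finite, and it spreads a small defect from
  the generators to any finite set.\<close>

lemma cocycle_linear_bound:
  assumes b: "cocycle b" and C: "\<And>s. s \<in> S \<Longrightarrow> P (b s) \<le> C" and g: "g \<in> carrier G"
  shows "P (b g) \<le> C * real (len g)"
proof -
  have "P (b (word_prod w)) \<le> C * real (length w)" if "set w \<subseteq> S" for w
    using that
  proof (induction w)
    case Nil
    then show ?case by (simp add: cocycle_one[OF b] norm_on_type_zero[OF P_norm])
  next
    case (Cons s w)
    then have s: "s \<in> S" "s \<in> carrier G" and w: "word_prod w \<in> carrier G"
      using gens_closed word_prod_closed by auto
    have "P (b (word_prod (s # w))) \<le> P (b s) + P (\<pi> s (b (word_prod w)))"
      using cocycleD[OF b s(2) w] norm_on_type_triangle[OF P_norm] by simp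
    also have "\<dots> \<le> C + C * real (length w)"
      using C[OF s(1)] Cons P_rep[OF s(2)] by (intro add_mono) auto
    finally show ?case by (simp add: algebra_simps)
  qed
  then show ?thesis
    using geodesic_word[OF g] by metis
qed

text \<open>For \<open>f\<close> norming \<open>x\<close>, \<open>P (x - \<pi> w y) \<le> r\<close>
  forces \<open>f (\<pi> w y) \<ge> P x - r > 0\<close>, which \<open>c0_rep\<close> allows for
  finitely many \<open>w\<close> only. The constant \<open>A\<close> makes \<open>f\<close>
  continuous for the original norm, in which \<open>c0_rep\<close> is stated.\<close>

lemma finite_near_translates:
  assumes c0: "c0_rep G \<pi>" and A: "\<And>x. P x \<le> A * norm x" and r: "r < P x"
  shows "finite {w \<in> carrier G. P (x - \<pi> w y) \<le> r}"
proof -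
  obtain f where f: "linear f" "\<And>z. f z \<le> P z" "f x = P x"
    using norming_functional_exists[OF sublinear_norm_on_type[OF P_norm]] by blast
  have "\<bar>f z\<bar> \<le> P z" for z
    using f(2)[of z] f(2)[of "- z"] linear_neg[OF f(1), of z] norm_on_type_minus[OF P_norm, of z]
    by simp
  then have "norm (f z) \<le> norm z * A" for z
    using A[of z] by (metis mult.commute order_trans real_norm_def)
  then have "bounded_linear f"
    using f(1) by (intro bounded_linear_intro[of f A])
      (auto simp: linear_add linear_scale)
  then obtain \<phi> where \<phi>: "f = blinfun_apply \<phi>"
    by (metis bounded_linear_Blinfun_apply)
  have "((\<lambda>w. f (\<pi> w y)) \<longlongrightarrow> 0) (inf cofinite (principal (carrier G)))"
    using c0 by (simp add: c0_rep_def \<phi>)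
  then have "\<forall>\<^sub>F w in inf cofinite (principal (carrier G)). f (\<pi> w y) < P x - r"
    using r by (intro order_tendstoD(2)) auto
  then have "finite {w. \<not> (w \<in> carrier G \<longrightarrow> f (\<pi> w y) < P x - r)}"
    by (simp add: eventually_inf_principal eventually_cofinite)
  moreover have "{w \<in> carrier G. P (x - \<pi> w y) \<le> r}
      \<subseteq> {w. \<not> (w \<in> carrier G \<longrightarrow> f (\<pi> w y) < P x - r)}"
  proof safe
    fix w assume "P (x - \<pi> w y) \<le> r" "f (\<pi> w y) < P x - r"
    then show False
      using f(2)[of "x - \<pi> w y"] f(3) linear_diff[OF f(1), of x "\<pi> w y"] by simp
  qed
  ultimately show ?thesis
    by (rule rev_finite_subset)
qed

text \<open>If the optimal linear growth rate \<open>c\<close> were positive, a long geodesic could be cut into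
  segments of a fixed length \<open>n\<close> whose increments are almost extremal on average. By uniform
  convexity two increments half the geodesic apart almost agree, so a cocycle value on the
  sphere of radius \<open>n\<close> is close to a translate of another one by an arbitrarily long group
  element, which the \<open>c\<^sub>0\<close> property forbids.\<close>

proposition cocycle_sublinear:
  assumes b: "cocycle b" and c0: "c0_rep G \<pi>" and A: "\<And>x. P x \<le> A * norm x"
    and uc: "\<And>\<epsilon>. 0 < \<epsilon> \<Longrightarrow> \<exists>\<delta>>0. \<forall>x y. P x \<le> 1 \<longrightarrow> P y \<le> 1 \<longrightarrow> \<epsilon> \<le> P (x - y)
      \<longrightarrow> P ((1/2) *\<^sub>R (x + y)) \<le> 1 - \<delta>"
    and "0 < \<epsilon>"
  shows "\<exists>K. \<forall>g\<in>carrier G. P (b g) \<le> \<epsilon> * real (len g) + K"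
proof (rule ccontr)
  assume no: "\<not> ?thesis"
  \<comment> \<open>The slopes of affine majorants of the growth; the infimum \<open>c\<close> is
    the optimal rate, and by \<open>no\<close> it is at least \<open>\<epsilon>\<close>.\<close>
  define B where "B = {a. 0 \<le> a \<and> (\<exists>K. \<forall>g\<in>carrier G. P (b g) \<le> a * real (len g) + K)}"
  define C where "C = 1 + (\<Sum>s\<in>S. P (b s))"
  have C: "1 \<le> C" "\<And>s. s \<in> S \<Longrightarrow> P (b s) \<le> C"
  proof -
    show "1 \<le> C"
      unfolding C_def by (simp add: sum_nonneg norm_on_type_nonneg[OF P_norm])
    show "P (b s) \<le> C" if "s \<in> S" for s
      using member_le_sum[of s S "\<lambda>s. P (b s)"] that finite_gens
      by (simp add: C_def norm_on_type_nonneg[OF P_norm])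
  qed
  have linear: "P (b g) \<le> C * real (len g)" if "g \<in> carrier G" for g
    using cocycle_linear_bound[OF b C(2) that] .
  have "C \<in> B"
    unfolding B_def using C(1) linear by (auto intro!: exI[of _ 0])
  have lower: "\<epsilon> \<le> a" if "a \<in> B" for a
  proof (rule ccontr)
    assume "\<not> \<epsilon> \<le> a"
    then have "a * real (len g) \<le> \<epsilon> * real (len g)" for g
      by (intro mult_right_mono) auto
    then have "\<exists>K. \<forall>g\<in>carrier G. P (b g) \<le> \<epsilon> * real (len g) + K"
      using that unfolding B_def by (smt (verit) mem_Collect_eq)
    with no show False by simp
  qed
  define c where "c = Inf B"
  have "\<epsilon> \<le> c"
    unfolding c_def using \<open>C \<in> B\<close> lower by (intro cInf_greatest) auto
  with \<open>0 < \<epsilon>\<close> have c: "0 < c" by simp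
  have bdd: "bdd_below B"
    using lower by (rule bdd_belowI)
  obtain \<delta> where \<delta>: "0 < \<delta>" "\<And>x y. P x \<le> 1 \<Longrightarrow> P y \<le> 1 \<Longrightarrow> 1/2 \<le> P (x - y)
      \<Longrightarrow> P ((1/2) *\<^sub>R (x + y)) \<le> 1 - \<delta>"
    using uc[of "1/2"] by auto
  \<comment> \<open>The bound \<open>c/24\<close> leaves room for
    \<open>(3/2) * R < 2 * (c - \<eta>) * n\<close>; the bound \<open>\<delta> * c / 4\<close> makes
    the convexity gain outweigh the slack in the growth rates.\<close>
  define \<eta> where "\<eta> = min (c/24) (\<delta> * c / 4)"
  have \<eta>: "0 < \<eta>" "24 * \<eta> \<le> c" "4 * \<eta> \<le> \<delta> * c"
    using c \<delta>(1) by (auto simp: \<eta>_def)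
  obtain a K1 where a: "a < c + \<eta>" "\<And>g. g \<in> carrier G \<Longrightarrow> P (b g) \<le> a * real (len g) + K1"
  proof -
    have "\<exists>a\<in>B. a < c + \<eta>"
      using \<open>C \<in> B\<close> \<eta>(1) bdd unfolding c_def by (subst cInf_less_iff[symmetric]) auto
    then show ?thesis using that unfolding B_def by blast
  qed
  \<comment> \<open>The segment length is chosen so large that the additive constant
    \<open>K1\<close> is absorbed into the slope.\<close>
  obtain n :: nat where n: "0 < n" "K1 \<le> real n * \<eta>"
  proof -
    obtain n0 :: nat where "K1 / \<eta> \<le> real n0"
      using real_arch_simple by blast
    then have "K1 \<le> real (Suc n0) * \<eta>"
      using \<eta>(1) by (simp add: field_simps)
    then show ?thesis using that[of "Suc n0"] by blast
  qed
  define R where "R = (c + 2 * \<eta>) * real n"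
  have R: "0 < R"
    using c \<eta>(1) n(1) by (simp add: R_def)
  have sphere: "P (b h) \<le> R" if "h \<in> carrier G" "len h = n" for h
  proof -
    have "a * real n \<le> (c + \<eta>) * real n"
      using a(1) by (intro mult_right_mono) auto
    then show ?thesis
      using a(2)[OF that(1)] that(2) n(2) by (simp add: R_def algebra_simps)
  qed
  \<comment> \<open>After scaling by \<open>1 / R\<close>, distance \<open>r\<close> is the
    separation \<open>1/2\<close> for which \<open>\<delta>\<close> was chosen.\<close>
  define r where "r = R/2"
  define near where "near = (\<Union>(h, h')\<in>{(h, h') \<in> {g \<in> carrier G. len g \<le> n} \<times> {g \<in> carrier G. len g \<le> n}.
    r < P (b h)}. {w \<in> carrier G. P (b h - \<pi> w (b h')) \<le> r})"
  have "finite near"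
    unfolding near_def
  proof (rule finite_UN_I)
    have "finite ({g \<in> carrier G. len g \<le> n} \<times> {g \<in> carrier G. len g \<le> n})"
      using finite_len_ball by blast
    then show "finite {(h, h') \<in> {g \<in> carrier G. len g \<le> n} \<times> {g \<in> carrier G. len g \<le> n}.
        r < P (b h)}"
      by (rule rev_finite_subset) auto
  qed (auto intro!: finite_near_translates[OF c0 A])
  then obtain L where L: "\<And>w. w \<in> near \<Longrightarrow> len w \<le> L"
    by (metis finite_imageI finite_nat_set_iff_bounded_le imageI)
  \<comment> \<open>This constant serves twice: it forces
    \<open>len g \<ge> 2 * n * (L + 1)\<close>, hence \<open>L < k\<close>, and it pays for the end
    of the geodesic beyond the last full segment. Since \<open>near\<close> depends on
    \<open>n\<close> but not on \<open>g\<close>, it can be fixed now.\<close>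
  define K2 where "K2 = C * real (2 * n * (L + 1))"
  have "c - \<eta> \<notin> B"
    using cInf_lower[OF _ bdd, of "c - \<eta>"] \<eta>(1) unfolding c_def by auto
  \<comment> \<open>As \<open>c - \<eta>\<close> is nonnegative, it can fail to lie in
    \<open>B\<close> only because no additive constant works, in particular not
    \<open>K2\<close>.\<close>
  then obtain g where g: "g \<in> carrier G" "(c - \<eta>) * real (len g) + K2 < P (b g)"
    using \<eta> c unfolding B_def by (auto simp: not_le)
  define m where "m = len g"
  define k where "k = m div (2 * n)"
  have "K2 \<le> C * real m"
    using linear[OF g(1)] g(2) \<eta> c
    by (smt (verit) m_def mult_nonneg_nonneg of_nat_0_le_iff)
  then have "2 * n * (L + 1) \<le> m"
    using C(1) unfolding K2_def by (simp only: mult_le_cancel_left_pos of_nat_le_iff)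
  then have k: "L < k"
    unfolding k_def using n(1)
    by (metis Suc_eq_plus1 Suc_le_eq div_le_mono mult_eq_0_iff nonzero_mult_div_cancel_left not_gr_zero zero_neq_numeral)
  have km: "2 * k * n \<le> m" and m_le: "m - 2 * k * n \<le> 2 * n"
  proof -
    have "m = 2 * k * n + m mod (2 * n)"
      unfolding k_def by (metis div_mult_mod_eq mult.assoc mult.commute)
    moreover have "m mod (2 * n) < 2 * n"
      using n(1) by simp
    ultimately show "2 * k * n \<le> m" "m - 2 * k * n \<le> 2 * n" by linarith+
  qed
  obtain x where x: "\<And>i. x i \<in> carrier G" "x 0 = \<one>" "x m = g"
    "\<And>i j. i \<le> j \<Longrightarrow> j \<le> m \<Longrightarrow> len (inv (x i) \<otimes> x j) = j - i"
    using geodesic_path[OF g(1)] unfolding m_def by metis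
  define y where "y i = x (i * n)" for i
  have y: "y i \<in> carrier G" for i
    by (simp add: y_def x)
  have len_y: "len (inv (y i) \<otimes> y j) = (j - i) * n" if "i \<le> j" "j \<le> 2 * k" for i j
  proof -
    have "j * n \<le> m"
      using that(2) km by (metis mult_le_mono1 order_trans)
    then show ?thesis
      using x(4)[of "i * n" "j * n"] that(1) by (simp add: y_def diff_mult_distrib)
  qed
  define v where "v i = b (y (Suc i)) - b (y i)" for i
  have v: "v i = \<pi> (y i) (b (inv (y i) \<otimes> y (Suc i)))" for i
    unfolding v_def by (rule cocycle_diff[OF b y y])
  have Pv: "P (v i) = P (b (inv (y i) \<otimes> y (Suc i)))" for i
    unfolding v by (rule P_rep[OF y])
  have v_le: "P (v i) \<le> R" if "i < 2 * k" for i
    unfolding Pv using that y len_y[of i "Suc i"] by (intro sphere) auto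
  have "(\<Sum>i<2 * k. v i) = b (y (2 * k)) - b (y 0)"
    unfolding v_def by (rule sum_lessThan_telescope)
  then have "(\<Sum>i<2 * k. v i) = b (y (2 * k))"
    using cocycle_one[OF b] x(2) by (simp add: y_def)
  \<comment> \<open>Pairing increments \<open>k\<close> segments apart, not adjacent ones, makes the
    element linking them longer than \<open>L\<close>.\<close>
  then have pairs: "(\<Sum>i<k. v i + v (i + k)) = b (y (2 * k))"
    using sum_lessThan_add[of v k k] by (simp add: sum.distrib mult_2)
  have "(c - \<eta>) * real (2 * k * n) \<le> P (b (y (2 * k)))"
  proof -
    have "P (b g - b (y (2 * k))) = P (b (inv (y (2 * k)) \<otimes> g))"
      using cocycle_diff[OF b y g(1)] P_rep[OF y] by simp
    also have "\<dots> \<le> C * real (len (inv (y (2 * k)) \<otimes> g))"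
      using y g(1) by (intro linear) auto
    also have "\<dots> \<le> C * real (2 * n * (L + 1))"
      using x(4)[OF km order_refl] x(3) m_le C(1)
      by (intro mult_left_mono of_nat_mono) (auto simp: y_def intro: order_trans)
    finally have "P (b g) \<le> P (b (y (2 * k))) + K2"
      using norm_on_type_triangle[OF P_norm, of "b (y (2 * k))" "b g - b (y (2 * k))"]
      by (simp add: K2_def)
    then have "(c - \<eta>) * real m \<le> P (b (y (2 * k)))"
      using g(2) by (simp add: m_def)
    moreover have "(c - \<eta>) * real (2 * k * n) \<le> (c - \<eta>) * real m"
      using \<eta> c km by (intro mult_left_mono of_nat_mono) auto
    ultimately show ?thesis by simp
  qed
  then have sum_ge: "real k * (2 * (c - \<eta>) * real n) \<le> P (\<Sum>i<k. v i + v (i + k))"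
    unfolding pairs by (simp add: algebra_simps)
  \<comment> \<open>Some pair is at least as large as the average over the \<open>k\<close>
    pairs.\<close>
  have "\<exists>i<k. 2 * (c - \<eta>) * real n \<le> P (v i + v (i + k))"
  proof (rule ccontr)
    assume "\<not> ?thesis"
    then have "P (v i + v (i + k)) < 2 * (c - \<eta>) * real n" if "i < k" for i
      using that by force
    then have "(\<Sum>i<k. P (v i + v (i + k))) < real (card {..<k}) * (2 * (c - \<eta>) * real n)"
      using k by (intro sum_bounded_above_strict) auto
    then show False
      using sum_ge norm_on_type_sum[OF P_norm, of "\<lambda>i. v i + v (i + k)" "{..<k}"] by simp
  qed
  then obtain i where i: "i < k" "2 * (c - \<eta>) * real n \<le> P (v i + v (i + k))"
    by blast
  let ?j = "i + k"
  have close: "P (v i - v ?j) < r"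
  proof (rule ccontr)
    assume far: "\<not> ?thesis"
    have scale: "P ((1/R) *\<^sub>R z) = P z / R" for z
      using R norm_on_type_scaleR[OF P_norm, of "1/R" z] by simp
    have "1/2 \<le> P (v i - v ?j) / R"
      using far R by (simp add: r_def field_simps)
    then have "1/2 \<le> P ((1/R) *\<^sub>R v i - (1/R) *\<^sub>R v ?j)"
      by (simp only: scale flip: scaleR_diff_right)
    then have "P ((1/2) *\<^sub>R ((1/R) *\<^sub>R v i + (1/R) *\<^sub>R v ?j)) \<le> 1 - \<delta>"
      using v_le i(1) R by (intro \<delta>(2)) (auto simp: scale)
    also have "(1/2) *\<^sub>R ((1/R) *\<^sub>R v i + (1/R) *\<^sub>R v ?j) = (1/2) *\<^sub>R (1/R) *\<^sub>R (v i + v ?j)"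
      by (simp add: algebra_simps)
    also have "P \<dots> = P (v i + v ?j) / (2 * R)"
      by (simp only: norm_on_type_scaleR[OF P_norm, of "1/2"] scale)
    finally have "P (v i + v ?j) \<le> 2 * R * (1 - \<delta>)"
      using R by (simp add: field_simps)
    with i(2) have "real n * (c - \<eta>) \<le> real n * ((c + 2 * \<eta>) * (1 - \<delta>))"
      by (simp add: R_def algebra_simps)
    then have "c - \<eta> \<le> (c + 2 * \<eta>) * (1 - \<delta>)"
      using n(1) by (simp only: mult_le_cancel_left_pos of_nat_0_less_iff)
    also have "\<dots> = c + 2 * \<eta> - \<delta> * c - 2 * (\<delta> * \<eta>)"
      by (simp add: algebra_simps)
    also have "\<dots> \<le> c - 2 * \<eta> - 2 * (\<delta> * \<eta>)"
      using \<eta> by simp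
    finally show False
      using mult_pos_pos[OF \<delta>(1) \<eta>(1)] \<eta>(1) by linarith
  qed
  define h h' w where "h = inv (y i) \<otimes> y (Suc i)" and "h' = inv (y ?j) \<otimes> y (Suc ?j)"
    and "w = inv (y i) \<otimes> y ?j"
  have carr: "h \<in> carrier G" "h' \<in> carrier G" "w \<in> carrier G"
    using y by (auto simp: h_def h'_def w_def)
  have lens: "len h = n" "len h' = n" "len w = k * n"
    using len_y[of i "Suc i"] len_y[of ?j "Suc ?j"] len_y[of i ?j] i(1)
    by (auto simp: h_def h'_def w_def)
  have "v i - v ?j = \<pi> (y i) (b h - \<pi> w (b h'))"
  proof -
    have "y ?j = y i \<otimes> w"
      using y by (simp add: w_def m_assoc[symmetric])
    then show ?thesis
      using v[of i] v[of ?j] rep_mult[OF y[of i] carr(3)]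
      by (simp add: h_def h'_def blinfun.diff_right)
  qed
  then have "P (b h - \<pi> w (b h')) < r"
    using close P_rep[OF y] by simp
  \<comment> \<open>An almost extremal sum with one summand at most \<open>R\<close> keeps the other
    one above \<open>r\<close>; this is the condition under which \<open>near\<close> is
    finite.\<close>
  moreover have "r < P (b h)"
  proof -
    have "2 * (c - \<eta>) * real n - R \<le> P (v i)"
      using i norm_on_type_triangle[OF P_norm, of "v i" "v ?j"] v_le[of ?j] by simp
    moreover have "r < 2 * (c - \<eta>) * real n - R"
    proof -
      have "(3/2) * (c + 2 * \<eta>) * real n < 2 * (c - \<eta>) * real n"
        using \<eta> c n(1) by (intro mult_strict_right_mono) auto
      then have "(3/2) * R < 2 * (c - \<eta>) * real n"
        by (simp only: R_def mult.assoc)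
      then show ?thesis by (simp add: r_def)
    qed
    ultimately show ?thesis by (simp add: Pv h_def)
  qed
  ultimately have "w \<in> near"
    unfolding near_def using carr lens by (intro UN_I[of "(h, h')"]) auto
  then have "k * n \<le> L"
    using L lens by metis
  with k n(1) show False
    by (metis One_nat_def Suc_leI leD le_trans mult.right_neutral mult_le_mono2)
qed

end

subsection \<open>Averaging over controlled Foelner sets\<close>

context isometric_rep
begin

definition coboundary_defect :: "('g \<Rightarrow> 'e) \<Rightarrow> 'e \<Rightarrow> 'g \<Rightarrow> 'e"
  where "coboundary_defect b \<xi> g = b g - (\<pi> g \<xi> - \<xi>)"

lemma cocycle_coboundary_defect:
  assumes "cocycle b"
  shows "cocycle (coboundary_defect b \<xi>)"
  unfolding cocycle_def coboundary_defect_def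
  using cocycleD[OF assms] rep_mult by (simp add: algebra_simps blinfun.bilinear_simps)

text \<open>The boundary is taken on the right, whereas \<open>b (s g) = b s + \<pi> s (b g)\<close> involves left
  translation; hence the average of \<open>b\<close> runs over the inverses of \<open>F\<close>. The base point \<open>f\<^sub>0\<close>
  keeps the arguments of length at most the diameter.\<close>

lemma folner_average:
  assumes b: "cocycle b" and F: "finite F" "F \<noteq> {}" "F \<subseteq> carrier G"
    and growth: "\<And>g. g \<in> carrier G \<Longrightarrow> P (b g) \<le> \<epsilon> * real (len g) + K" and "0 \<le> \<epsilon>"
  obtains \<xi> where "\<And>s. s \<in> S \<Longrightarrow> P (coboundary_defect b \<xi> s)
    \<le> 2 * (real (card (cayley_boundary G S F)) / real (card F))
        * (\<epsilon> * (real (word_diam G S F) + 1) + K)"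
proof -
  obtain f0 where f0: "f0 \<in> F" using F(2) by blast
  with F(3) have f0c: "f0 \<in> carrier G" by blast
  \<comment> \<open>The extra 1 covers the translated set, where the arguments of \<open>b\<close>
    gain one letter.\<close>
  define M where "M = \<epsilon> * (real (word_diam G S F) + 1) + K"
  define u where "u g = b (inv g \<otimes> f0)" for g
  \<comment> \<open>The sign is negative because a fixed point \<open>z\<close> of
    \<open>z \<mapsto> \<pi> s z + b s\<close> exhibits \<open>b\<close> as the coboundary of
    \<open>- z\<close>.\<close>
  define \<xi> where "\<xi> = - ((1 / real (card F)) *\<^sub>R (\<Sum>g\<in>F. u g))"
  have card: "0 < card F" using F by (simp add: card_gt_0_iff)
  have u_bound: "P (u g) \<le> M" if "g \<in> carrier G" "len (inv g \<otimes> f0) \<le> word_diam G S F + 1" for g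
  proof -
    have "\<epsilon> * real (len (inv g \<otimes> f0)) \<le> \<epsilon> * (real (word_diam G S F) + 1)"
      using that(2) \<open>0 \<le> \<epsilon>\<close> by (intro mult_left_mono) linarith+
    then show ?thesis
      using growth[of "inv g \<otimes> f0"] that(1) f0c by (simp add: u_def M_def)
  qed
  have diam: "len (inv g \<otimes> f0) \<le> word_diam G S F" if "g \<in> F" for g
    unfolding word_diam_def using F(1) f0 that
    by (intro Max_ge) (auto simp: word_dist_def intro!: rev_image_eqI[of "(g, f0)"])
  have "P (coboundary_defect b \<xi> s)
      \<le> 2 * (real (card (cayley_boundary G S F)) / real (card F)) * M" if s: "s \<in> S" for s
  proof -
    have sc: "s \<in> carrier G" using s gens_closed by blast
    define t where "t = inv s"
    have tc: "t \<in> carrier G" and tS: "t \<in> S" using sc s gens_inv by (auto simp: t_def)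
    define F' where "F' = (\<lambda>g. g \<otimes> t) ` F"
    have inj: "inj_on (\<lambda>g. g \<otimes> t) F"
      using F(3) tc by (intro inj_onI) (auto simp: subset_iff)
    have F': "finite F'" "F' \<subseteq> carrier G"
      unfolding F'_def using F tc by auto
    \<comment> \<open>The affine action of \<open>s\<close> permutes the values of \<open>u\<close>
      by right translation with \<open>inv s\<close>, so the average over \<open>F\<close> becomes
      the average over \<open>F'\<close>.\<close>
    have shift: "b s + \<pi> s (u g) = u (g \<otimes> t)" if g: "g \<in> F" for g
    proof -
      have gc: "g \<in> carrier G" using g F by blast
      have "inv (g \<otimes> t) \<otimes> f0 = s \<otimes> (inv g \<otimes> f0)"
        using gc tc sc f0c by (simp add: t_def inv_mult_group m_assoc)
      then show ?thesis
        using cocycleD[OF b sc, of "inv g \<otimes> f0"] gc f0c by (simp add: u_def)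
    qed
    have "(\<Sum>g\<in>F. b s + \<pi> s (u g)) = sum u F'"
      unfolding F'_def using shift by (simp add: sum.reindex[OF inj])
    then have "real (card F) *\<^sub>R b s + \<pi> s (sum u F) = sum u F'"
      by (simp add: sum.distrib blinfun.sum_right sum_constant_scaleR del: sum_constant)
    then have "(1 / real (card F)) *\<^sub>R (real (card F) *\<^sub>R b s + \<pi> s (sum u F))
        = (1 / real (card F)) *\<^sub>R sum u F'" by simp
    then have avg: "b s + (1 / real (card F)) *\<^sub>R \<pi> s (sum u F) = (1 / real (card F)) *\<^sub>R sum u F'"
      using card by (simp add: scaleR_add_right)
    have "coboundary_defect b \<xi> s
        = (b s + (1 / real (card F)) *\<^sub>R \<pi> s (sum u F)) - (1 / real (card F)) *\<^sub>R sum u F"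
      by (simp add: coboundary_defect_def \<xi>_def blinfun.bilinear_simps)
    also have "\<dots> = (1 / real (card F)) *\<^sub>R (sum u F' - sum u F)"
      by (simp only: avg scaleR_diff_right)
    \<comment> \<open>The common part cancels. Each remaining difference has at most as many points
      as the boundary, one through \<open>t\<close> and the other through \<open>s\<close>; hence
      the factor 2.\<close>
    also have "sum u F' - sum u F = sum u (F' - F) - sum u (F - F')"
      using sum.Int_Diff[OF F'(1), of u F] sum.Int_Diff[OF F(1), of u F'] by (simp add: Int_commute)
    finally have defect: "coboundary_defect b \<xi> s
        = (1 / real (card F)) *\<^sub>R (sum u (F' - F) - sum u (F - F'))" .
    have "P (sum u (F' - F)) \<le> real (card (cayley_boundary G S F)) * M"
    proof -
      have sub: "F' - F \<subseteq> (\<lambda>g. g \<otimes> t) ` cayley_boundary G S F"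
        using tS by (auto simp: F'_def cayley_boundary_def)
      have "finite (cayley_boundary G S F)"
        using F(1) by (simp add: cayley_boundary_def)
      then have le: "card (F' - F) \<le> card (cayley_boundary G S F)"
        using sub by (meson card_image_le card_mono finite_imageI order_trans)
      have bd: "P (u h) \<le> M" if h: "h \<in> F' - F" for h
      proof -
        obtain g where g: "g \<in> F" "h = g \<otimes> t" using h by (auto simp: F'_def)
        have gc: "g \<in> carrier G" using g F by blast
        have "inv h \<otimes> f0 = s \<otimes> (inv g \<otimes> f0)"
          using gc tc sc f0c by (simp add: g t_def inv_mult_group m_assoc)
        then have "len (inv h \<otimes> f0) \<le> len s + len (inv g \<otimes> f0)"
          using len_mult[OF sc, of "inv g \<otimes> f0"] gc f0c by simp
        then show ?thesis
          using h F'(2) len_gen[OF s] diam[OF g(1)] by (intro u_bound) auto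
      qed
      have "P (sum u (F' - F)) \<le> (\<Sum>h\<in>F' - F. P (u h))"
        by (rule norm_on_type_sum[OF P_norm])
      also have "\<dots> \<le> real (card (F' - F)) * M"
        using bd by (intro sum_bounded_above)
      also have "\<dots> \<le> real (card (cayley_boundary G S F)) * M"
      proof (intro mult_right_mono of_nat_mono le)
        show "0 \<le> M"
          using u_bound[OF f0c] norm_on_type_nonneg[OF P_norm, of "u f0"] diam[OF f0] by simp
      qed
      finally show ?thesis .
    qed
    moreover have "P (sum u (F - F')) \<le> real (card (cayley_boundary G S F)) * M"
    proof -
      have sub: "F - F' \<subseteq> cayley_boundary G S F"
      proof
        fix g assume g: "g \<in> F - F'"
        then have gc: "g \<in> carrier G" using F by blast
        have "g \<otimes> s \<notin> F"
        proof
          assume "g \<otimes> s \<in> F"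
          then have "g \<otimes> s \<otimes> t \<in> F'" by (simp add: F'_def)
          moreover have "g \<otimes> s \<otimes> t = g" using gc sc by (simp add: t_def m_assoc)
          ultimately show False using g by simp
        qed
        with g s show "g \<in> cayley_boundary G S F" by (auto simp: cayley_boundary_def)
      qed
      have "P (sum u (F - F')) \<le> (\<Sum>h\<in>F - F'. P (u h))"
        by (rule norm_on_type_sum[OF P_norm])
      also have "\<dots> \<le> real (card (F - F')) * M"
        using F(3) by (intro sum_bounded_above u_bound) (auto intro: le_SucI diam)
      also have "\<dots> \<le> real (card (cayley_boundary G S F)) * M"
      proof (intro mult_right_mono of_nat_mono)
        show "card (F - F') \<le> card (cayley_boundary G S F)"
          using sub F(1) by (intro card_mono) (auto simp: cayley_boundary_def)
        show "0 \<le> M"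
          using u_bound[OF f0c] norm_on_type_nonneg[OF P_norm, of "u f0"] diam[OF f0] by simp
      qed
      finally show ?thesis .
    qed
    ultimately have "P (sum u (F' - F) - sum u (F - F'))
        \<le> 2 * (real (card (cayley_boundary G S F)) * M)"
      using norm_on_type_diff[OF P_norm, of "sum u (F' - F)" "sum u (F - F')"] by linarith
    moreover have "P (coboundary_defect b \<xi> s)
        = P (sum u (F' - F) - sum u (F - F')) / real (card F)"
      by (simp only: defect norm_on_type_scaleR[OF P_norm]) simp
    ultimately show ?thesis
      using card by (simp add: field_simps)
  qed
  then show ?thesis
    using that unfolding M_def by blast
qed

text \<open>The averaging bound splits into \<open>2 * \<epsilon> * \<rho> n * diam\<close>, at most
  \<open>2 * \<epsilon> * C = e / 2\<close> for every \<open>n \<ge> 1\<close>, and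
  \<open>2 * (\<epsilon> + K) * \<rho> n\<close>, which tends to 0. As \<open>K\<close> depends on
  \<open>\<epsilon>\<close>, the index \<open>n\<close> is chosen last.\<close>

lemma small_defect_on_generators:
  assumes b: "cocycle b" and F: "controlled_folner_sequence G S F"
    and sublinear: "\<And>\<epsilon>. 0 < \<epsilon> \<Longrightarrow> \<exists>K. \<forall>g\<in>carrier G. P (b g) \<le> \<epsilon> * real (len g) + K"
    and "0 < e"
  obtains \<xi> where "\<And>s. s \<in> S \<Longrightarrow> P (coboundary_defect b \<xi> s) \<le> e"
proof -
  obtain C where C: "0 < C" "\<And>n. 1 \<le> n \<Longrightarrow>
      real (card (cayley_boundary G S (F n))) * real (word_diam G S (F n)) \<le> C * real (card (F n))"
    using F unfolding controlled_folner_sequence_def by blast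
  have fin: "finite (F n)" "F n \<noteq> {}" "F n \<subseteq> carrier G" if "1 \<le> n" for n
    using F that by (auto simp: controlled_folner_sequence_def folner_sequence_def)
  define \<rho> where "\<rho> n = real (card (cayley_boundary G S (F n))) / real (card (F n))" for n
  have "\<rho> \<longlonglongrightarrow> 0"
    using F by (simp add: controlled_folner_sequence_def folner_sequence_def \<rho>_def[abs_def])
  define \<epsilon> where "\<epsilon> = e / (4 * C)"
  have "0 < \<epsilon>" using C \<open>0 < e\<close> by (simp add: \<epsilon>_def)
  then obtain K where K: "\<And>g. g \<in> carrier G \<Longrightarrow> P (b g) \<le> \<epsilon> * real (len g) + K"
    using sublinear by blast
  have "(\<lambda>n. 2 * (\<epsilon> + K) * \<rho> n) \<longlonglongrightarrow> 2 * (\<epsilon> + K) * 0"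
    using \<open>\<rho> \<longlonglongrightarrow> 0\<close> by (intro tendsto_mult tendsto_const)
  then have "\<forall>\<^sub>F n in sequentially. 2 * (\<epsilon> + K) * \<rho> n < e / 2"
    using \<open>0 < e\<close> by (intro order_tendstoD(2)) auto
  then obtain n where n: "1 \<le> n" "2 * (\<epsilon> + K) * \<rho> n < e / 2"
    unfolding eventually_sequentially by (metis max.cobounded1 max.cobounded2)
  have "0 < card (F n)" using fin[OF n(1)] by (simp add: card_gt_0_iff)
  then have "\<rho> n * real (word_diam G S (F n)) \<le> C"
    using C(2)[OF n(1)] by (simp add: \<rho>_def field_simps)
  then have "2 * \<epsilon> * (\<rho> n * real (word_diam G S (F n))) \<le> 2 * \<epsilon> * C"
    using \<open>0 < \<epsilon>\<close> by (intro mult_left_mono) auto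
  also have "\<dots> = e / 2"
    using C(1) by (simp add: \<epsilon>_def)
  finally have "2 * \<rho> n * (\<epsilon> * (real (word_diam G S (F n)) + 1) + K) \<le> e"
    using n(2) by (simp add: algebra_simps)
  moreover obtain \<xi> where "\<And>s. s \<in> S \<Longrightarrow> P (coboundary_defect b \<xi> s)
      \<le> 2 * \<rho> n * (\<epsilon> * (real (word_diam G S (F n)) + 1) + K)"
    using folner_average[OF b fin[OF n(1)] K] \<open>0 < \<epsilon>\<close> unfolding \<rho>_def by (metis less_imp_le)
  ultimately show ?thesis
    using that by (meson order_trans)
qed

text \<open>The defect is itself a cocycle, so its size at \<open>g\<close> is at most
  \<open>len g\<close> times its bound on \<open>S\<close>. Dividing \<open>e\<close> by
  \<open>L + 1\<close> keeps the final inequality strict and the divisor nonzero.\<close>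

proposition sublinear_cocycle_approximation:
  assumes b: "cocycle b" and F: "controlled_folner_sequence G S F"
    and sublinear: "\<And>\<epsilon>. 0 < \<epsilon> \<Longrightarrow> \<exists>K. \<forall>g\<in>carrier G. P (b g) \<le> \<epsilon> * real (len g) + K"
    and T: "finite T" "T \<subseteq> carrier G" and "0 < e"
  obtains \<xi> where "\<And>g. g \<in> T \<Longrightarrow> P (coboundary_defect b \<xi> g) < e"
proof -
  obtain L where L: "\<And>g. g \<in> T \<Longrightarrow> len g \<le> L"
    using T(1) by (metis finite_imageI finite_nat_set_iff_bounded_le imageI)
  define d where "d = e / (real L + 1)"
  have "0 < d" using \<open>0 < e\<close> by (simp add: d_def)
  then obtain \<xi> where \<xi>: "\<And>s. s \<in> S \<Longrightarrow> P (coboundary_defect b \<xi> s) \<le> d"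
    using small_defect_on_generators[OF b F sublinear] by blast
  have "P (coboundary_defect b \<xi> g) < e" if "g \<in> T" for g
  proof -
    have "P (coboundary_defect b \<xi> g) \<le> d * real (len g)"
      using that T(2) \<xi> by (intro cocycle_linear_bound cocycle_coboundary_defect b) auto
    also have "\<dots> \<le> d * real L"
      using L[OF that] \<open>0 < d\<close> by simp
    also have "\<dots> < e"
      using \<open>0 < e\<close> by (simp add: d_def field_simps)
    finally show ?thesis .
  qed
  then show ?thesis using that by blast
qed

end

subsection \<open>An invariant uniformly convex norm\<close>

text \<open>A supremum of uniformly convex norms can lose convexity; here one
  \<open>\<delta>\<close> serves the whole orbit, because vectors separated in \<open>P\<close> are
  separated by a fixed proportion under every \<open>N (\<pi> g _)\<close>.\<close>

lemma invariant_uniformly_convex_norm: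
  fixes \<pi> :: "'g \<Rightarrow> 'e::banach \<Rightarrow>\<^sub>L 'e"
  assumes "group G"
    and one: "\<And>x. \<pi> \<one>\<^bsub>G\<^esub> x = x"
    and mult: "\<And>g h x. g \<in> carrier G \<Longrightarrow> h \<in> carrier G \<Longrightarrow> \<pi> (g \<otimes>\<^bsub>G\<^esub> h) x = \<pi> g (\<pi> h x)"
    and "uniformly_bounded_rep G \<pi>" and "superreflexive TYPE('e)"
  obtains P where "norm_on_type P" "\<And>g x. g \<in> carrier G \<Longrightarrow> P (\<pi> g x) = P x"
    "\<exists>c>0. \<exists>C>0. \<forall>x. c * norm x \<le> P x \<and> P x \<le> C * norm x"
    "\<And>\<epsilon>. 0 < \<epsilon> \<Longrightarrow> \<exists>\<delta>>0. \<forall>x y. P x \<le> 1 \<longrightarrow> P y \<le> 1 \<longrightarrow> \<epsilon> \<le> P (x - y)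
      \<longrightarrow> P ((1/2) *\<^sub>R (x + y)) \<le> 1 - \<delta>"
proof -
  interpret group G by fact
  obtain N :: "'e \<Rightarrow> real" where N: "norm_on_type N" and uc: "uniformly_convex N"
    and equiv: "\<exists>c>0. \<exists>C>0. \<forall>x. c * norm x \<le> N x \<and> N x \<le> C * norm x"
    using assms(5) by (auto simp: superreflexive_def equivalent_norm_def)
  obtain c C where c: "0 < c" "\<And>x. c * norm x \<le> N x" and C: "0 < C" "\<And>x. N x \<le> C * norm x"
    using equiv by blast
  obtain D where D: "0 < D" "\<And>g. g \<in> carrier G \<Longrightarrow> norm (\<pi> g) \<le> D"
    using assms(4) by (auto simp: uniformly_bounded_rep_def)
  have rep_le: "norm (\<pi> g x) \<le> D * norm x" if "g \<in> carrier G" for g x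
    using norm_blinfun[of "\<pi> g" x] D(2)[OF that] by (meson mult_right_mono norm_ge_zero order_trans)
  have N_le: "N (\<pi> g x) \<le> C * D * norm x" if "g \<in> carrier G" for g x
    using order_trans[OF C(2) mult_left_mono[OF rep_le[OF that, of x], of C]] C(1)
    by (simp add: mult.assoc)
  define P where "P x = (SUP g\<in>carrier G. N (\<pi> g x))" for x
  have upper: "N (\<pi> g x) \<le> P x" if "g \<in> carrier G" for g x
    unfolding P_def using that N_le by (intro cSUP_upper bdd_aboveI2[of _ _ "C * D * norm x"])
  have least: "P x \<le> M" if "\<And>g. g \<in> carrier G \<Longrightarrow> N (\<pi> g x) \<le> M" for x M
    unfolding P_def using that by (intro cSUP_least) auto
  have N_le_P: "N x \<le> P x" for x
    using upper[of "\<one>\<^bsub>G\<^esub>" x] one by simp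
  have P_le: "P x \<le> C * D * norm x" for x
    using N_le by (intro least)
  have scale_le: "P (a *\<^sub>R x) \<le> \<bar>a\<bar> * P x" for a x
    using upper by (intro least)
      (auto simp: blinfun.scaleR_right norm_on_type_scaleR[OF N] intro!: mult_left_mono)
  have norm_P: "norm_on_type P"
    unfolding norm_on_type_def
  proof (intro conjI allI)
    show nonneg: "0 \<le> P x" for x
      using N_le_P[of x] norm_on_type_nonneg[OF N, of x] by simp
    show "P x = 0 \<longleftrightarrow> x = 0" for x
      using N_le_P[of x] norm_on_type_nonneg[OF N, of x] norm_on_type_eq_0[OF N, of x]
        P_le[of x] nonneg[of x] by auto
    show "P (a *\<^sub>R x) = \<bar>a\<bar> * P x" for a x
    proof (rule antisym[OF scale_le])
      show "\<bar>a\<bar> * P x \<le> P (a *\<^sub>R x)"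
      proof (cases "a = 0")
        case False
        then show ?thesis
          using scale_le[of "1/a" "a *\<^sub>R x"] by (simp add: field_simps)
      qed (simp add: nonneg)
    qed
    show "P (x + y) \<le> P x + P y" for x y
    proof (rule least)
      fix g assume g: "g \<in> carrier G"
      show "N (\<pi> g (x + y)) \<le> P x + P y"
        using norm_on_type_triangle[OF N, of "\<pi> g x" "\<pi> g y"] upper[OF g, of x] upper[OF g, of y]
        by (simp add: blinfun.add_right)
    qed
  qed
  have rep_P_le: "P (\<pi> h x) \<le> P x" if "h \<in> carrier G" for h x
    using upper that mult by (intro least) (metis m_closed)
  have rep_inv: "\<pi> (inv\<^bsub>G\<^esub> h) (\<pi> h x) = x" if "h \<in> carrier G" for h x
    using mult[of "inv\<^bsub>G\<^esub> h" h x] that one by simp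
  have inv_P: "P (\<pi> h x) = P x" if "h \<in> carrier G" for h x
    using rep_P_le[OF that, of x] rep_P_le[OF inv_closed[OF that], of "\<pi> h x"] rep_inv[OF that, of x]
    by simp
  define \<kappa> where "\<kappa> = c / (C * D)"
  have "0 < \<kappa>" using c(1) C(1) D(1) by (simp add: \<kappa>_def)
  \<comment> \<open>Invariance replaces \<open>P x\<close> by \<open>P (\<pi> g x)\<close>, and the
    two norms are then compared at the single vector \<open>\<pi> g x\<close>, so
    \<open>\<kappa>\<close> does not depend on \<open>g\<close>.\<close>
  have lower: "\<kappa> * P x \<le> N (\<pi> g x)" if "g \<in> carrier G" for g x
  proof -
    have "\<kappa> * P x = \<kappa> * P (\<pi> g x)" by (simp add: inv_P[OF that])
    also have "\<dots> \<le> \<kappa> * (C * D * norm (\<pi> g x))"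
      using \<open>0 < \<kappa>\<close> P_le by (intro mult_left_mono) auto
    also have "\<dots> = c * norm (\<pi> g x)"
      using C(1) D(1) by (simp add: \<kappa>_def)
    finally show ?thesis using c(2) order_trans by blast
  qed
  have "\<exists>c>0. \<exists>C>0. \<forall>x. c * norm x \<le> P x \<and> P x \<le> C * norm x"
    using c C(1) D(1) P_le N_le_P by (intro exI[of _ c] conjI exI[of _ "C * D"])
      (auto intro: order_trans)
  moreover have "\<exists>\<delta>>0. \<forall>x y. P x \<le> 1 \<longrightarrow> P y \<le> 1 \<longrightarrow> \<epsilon> \<le> P (x - y)
      \<longrightarrow> P ((1/2) *\<^sub>R (x + y)) \<le> 1 - \<delta>" if "0 < \<epsilon>" for \<epsilon>
  proof -
    obtain \<delta> where \<delta>: "0 < \<delta>" "\<And>x y. N x \<le> 1 \<Longrightarrow> N y \<le> 1 \<Longrightarrow> \<kappa> * \<epsilon> \<le> N (x - y)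
        \<Longrightarrow> N ((1/2) *\<^sub>R (x + y)) \<le> 1 - \<delta>"
      using uniformly_convex_ball[OF N uc mult_pos_pos[OF \<open>0 < \<kappa>\<close> \<open>0 < \<epsilon>\<close>]] by blast
    have "P ((1/2) *\<^sub>R (x + y)) \<le> 1 - \<delta>"
      if x: "P x \<le> 1" and y: "P y \<le> 1" and xy: "\<epsilon> \<le> P (x - y)" for x y
    proof (rule least)
      fix g assume g: "g \<in> carrier G"
      have "\<kappa> * \<epsilon> \<le> \<kappa> * P (x - y)"
        using xy \<open>0 < \<kappa>\<close> by simp
      also have "\<dots> \<le> N (\<pi> g x - \<pi> g y)"
        using lower[OF g, of "x - y"] by (simp add: blinfun.diff_right)
      finally have "N ((1/2) *\<^sub>R (\<pi> g x + \<pi> g y)) \<le> 1 - \<delta>"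
        using upper[OF g, of x] upper[OF g, of y] x y by (intro \<delta>(2)) auto
      then show "N (\<pi> g ((1/2) *\<^sub>R (x + y))) \<le> 1 - \<delta>"
        by (simp add: blinfun.scaleR_right blinfun.add_right)
    qed
    with \<delta>(1) show ?thesis by blast
  qed
  ultimately show ?thesis
    using norm_P inv_P that by blast
qed

subsection \<open>Reduced cohomology\<close>

lemma monoid_bounded_operators: "monoid bounded_operators"
  by (rule monoidI) (auto simp: bounded_operators_def intro!: blinfun_eqI)

lemma group_GL: "group GL"
  unfolding GL_def by (rule monoid.units_group[OF monoid_bounded_operators])

lemma mult_GL: "A \<otimes>\<^bsub>GL\<^esub> B = A o\<^sub>L B" and one_GL: "\<one>\<^bsub>GL\<^esub> = id_blinfun"
  by (simp_all add: GL_def bounded_operators_def units_of_def)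

lemma
  assumes "group G" and "group_representation G \<pi>"
  shows group_representation_one: "\<pi> \<one>\<^bsub>G\<^esub> x = x"
    and group_representation_mult:
      "g \<in> carrier G \<Longrightarrow> h \<in> carrier G \<Longrightarrow> \<pi> (g \<otimes>\<^bsub>G\<^esub> h) x = \<pi> g (\<pi> h x)"
proof -
  interpret group_hom G GL \<pi>
    using assms group_GL by (simp add: group_hom_def group_hom_axioms_def group_representation_def)
  show "\<pi> \<one>\<^bsub>G\<^esub> x = x"
    using hom_one by (simp add: one_GL)
  show "\<pi> (g \<otimes>\<^bsub>G\<^esub> h) x = \<pi> g (\<pi> h x)" if "g \<in> carrier G" "h \<in> carrier G"
    using hom_mult[OF that] by (simp add: mult_GL)
qed

lemma comm_group_cocycle_group:
  assumes "group G"
  shows "comm_group (cocycle_group G \<pi>)"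
proof (rule comm_groupI)
  interpret group G by fact
  have add: "(\<lambda>g\<in>carrier G. b g + c g) \<in> cocycles G \<pi>"
    if "b \<in> cocycles G \<pi>" "c \<in> cocycles G \<pi>" for b c
    using that by (auto simp: cocycles_def blinfun.add_right algebra_simps)
  have zero: "(\<lambda>g\<in>carrier G. 0) \<in> cocycles G \<pi>"
    by (auto simp: cocycles_def)
  have neg: "(\<lambda>g\<in>carrier G. - b g) \<in> cocycles G \<pi>" if "b \<in> cocycles G \<pi>" for b
    using that by (auto simp: cocycles_def blinfun.minus_right)
  let ?Z = "cocycle_group G \<pi>"
  show "b \<otimes>\<^bsub>?Z\<^esub> c \<in> carrier ?Z" if "b \<in> carrier ?Z" "c \<in> carrier ?Z" for b c
    using that add by (simp add: cocycle_group_def)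
  show "\<one>\<^bsub>?Z\<^esub> \<in> carrier ?Z"
    using zero by (simp add: cocycle_group_def)
  show "(b \<otimes>\<^bsub>?Z\<^esub> c) \<otimes>\<^bsub>?Z\<^esub> d = b \<otimes>\<^bsub>?Z\<^esub> (c \<otimes>\<^bsub>?Z\<^esub> d)" for b c d
    by (auto simp: cocycle_group_def add.assoc intro!: restrict_ext)
  show "b \<otimes>\<^bsub>?Z\<^esub> c = c \<otimes>\<^bsub>?Z\<^esub> b" for b c
    by (auto simp: cocycle_group_def add.commute)
  \<comment> \<open>Extensionality matters here: the restricted sum returns \<open>b\<close> only if
    \<open>b\<close> is \<open>undefined\<close> off the carrier.\<close>
  show "\<one>\<^bsub>?Z\<^esub> \<otimes>\<^bsub>?Z\<^esub> b = b" if "b \<in> carrier ?Z" for b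
    using that by (auto simp: cocycle_group_def cocycles_def intro!: extensionalityI[of _ "carrier G"])
  show "\<exists>c\<in>carrier ?Z. c \<otimes>\<^bsub>?Z\<^esub> b = \<one>\<^bsub>?Z\<^esub>" if "b \<in> carrier ?Z" for b
    using that neg[of b] by (intro bexI[of _ "\<lambda>g\<in>carrier G. - b g"])
      (auto simp: cocycle_group_def intro!: restrict_ext)
qed

lemma trivial_group_Mod_carrier:
  assumes "group G"
  shows "trivial_group (G Mod carrier G)"
proof -
  interpret group G by fact
  have sub: "subgroup (carrier G) G"
    by (rule subgroup_self)
  have coset: "carrier G #>\<^bsub>G\<^esub> x = carrier G" if "x \<in> carrier G" for x
    using that sub by (intro coset_join2) auto
  have "carrier G \<lhd> G"
    using sub by (simp add: normal_inv_iff)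
  then have "group (G Mod carrier G)"
    by (rule normal.factorgroup_is_group)
  moreover have "carrier (G Mod carrier G) = {\<one>\<^bsub>G Mod carrier G\<^esub>}"
    using coset by (auto simp: FactGroup_def RCOSETS_def)
  ultimately show ?thesis
    by (simp add: trivial_group_def)
qed

lemma coboundaries_subset_cocycles:
  assumes "group G" and "group_representation G \<pi>"
  shows "coboundaries G \<pi> \<subseteq> cocycles G \<pi>"
proof -
  interpret group G by fact
  show ?thesis
    using group_representation_mult[OF assms]
    by (auto simp: coboundaries_def cocycles_def blinfun.diff_right)
qed

lemma almost_coboundaries_subset_cocycles: "almost_coboundaries G \<pi> \<subseteq> cocycles G \<pi>"
  using closure_of_subset_topspace[of "cocycle_topology G \<pi>"]
  by (auto simp: almost_coboundaries_def cocycle_topology_def)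

text \<open>A basic open set of the product topology constrains finitely many coordinates, so norm
  approximation on finite sets suffices; passing to the subspace is harmless because coboundaries
  are cocycles.\<close>

lemma almost_coboundariesI:
  fixes \<pi> :: "'g \<Rightarrow> 'e::banach \<Rightarrow>\<^sub>L 'e"
  assumes "group G" "group_representation G \<pi>" and b: "b \<in> cocycles G \<pi>"
    and approx: "\<And>T e. finite T \<Longrightarrow> T \<subseteq> carrier G \<Longrightarrow> 0 < e \<Longrightarrow>
      \<exists>\<xi>. \<forall>g\<in>T. norm (b g - (\<pi> g \<xi> - \<xi>)) < e"
  shows "b \<in> almost_coboundaries G \<pi>"
proof -
  let ?X = "product_topology (\<lambda>_. euclidean) (carrier G) :: ('g \<Rightarrow> 'e) topology"
  have "b \<in> ?X closure_of coboundaries G \<pi>"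
    unfolding in_closure_of
  proof (intro conjI allI impI)
    show "b \<in> topspace ?X"
      using b by (simp add: cocycles_def PiE_def)
    fix V assume V: "b \<in> V \<and> openin ?X V"
    then obtain U where U: "finite {g \<in> carrier G. U g \<noteq> (UNIV :: 'e set)}"
      "\<And>g. g \<in> carrier G \<Longrightarrow> open (U g)" "b \<in> Pi\<^sub>E (carrier G) U" "Pi\<^sub>E (carrier G) U \<subseteq> V"
      by (auto simp: openin_product_topology_alt)
    define T where "T = {g \<in> carrier G. U g \<noteq> (UNIV :: 'e set)}"
    have "\<exists>e>0. ball (b g) e \<subseteq> U g" if "g \<in> T" for g
    proof -
      have "open (U g)" "b g \<in> U g" using that U(2,3) by (auto simp: T_def)
      then show ?thesis by (simp add: open_contains_ball)
    qed
    then obtain r where r: "\<And>g. g \<in> T \<Longrightarrow> 0 < r g \<and> ball (b g) (r g) \<subseteq> U g"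
      by metis
    \<comment> \<open>The inserted 1 gives a positive minimum even when \<open>T\<close> is
      empty.\<close>
    define e where "e = Min (insert 1 (r ` T))"
    have T: "finite T" "T \<subseteq> carrier G"
      using U(1) by (auto simp: T_def)
    have "0 < e"
      unfolding e_def using T(1) r by simp
    then obtain \<xi> where \<xi>: "\<And>g. g \<in> T \<Longrightarrow> norm (b g - (\<pi> g \<xi> - \<xi>)) < e"
      using approx[OF T] by blast
    have "(\<lambda>g\<in>carrier G. \<pi> g \<xi> - \<xi>) \<in> Pi\<^sub>E (carrier G) U"
    proof (rule restrict_PiE_iff[THEN iffD2], rule ballI)
      fix g assume g: "g \<in> carrier G"
      show "\<pi> g \<xi> - \<xi> \<in> U g"
      proof (cases "g \<in> T")
        case True
        then have "e \<le> r g" using T(1) by (simp add: e_def)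
        with True \<xi>[OF True] r[OF True] show ?thesis
          by (auto simp: subset_iff dist_norm)
      next
        case False
        with g show ?thesis by (simp add: T_def)
      qed
    qed
    then show "\<exists>y. y \<in> coboundaries G \<pi> \<and> y \<in> V"
      using U(4) unfolding coboundaries_def by blast
  qed
  moreover have "cocycles G \<pi> \<inter> coboundaries G \<pi> = coboundaries G \<pi>"
    using coboundaries_subset_cocycles[OF assms(1,2)] by blast
  ultimately show ?thesis
    using b by (simp add: almost_coboundaries_def cocycle_topology_def closure_of_subtopology)
qed

theorem corollary5:
  fixes G :: "('g, 'm) monoid_scheme"
    and S :: "'g set"
    and \<pi> :: "'g \<Rightarrow> 'e::banach \<Rightarrow>\<^sub>L 'e"
  assumes "group G"
    and "finite S"
    and "symmetric_generating_set G S"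
    and "amenable G"
    and "\<exists>F. controlled_folner_sequence G S F"
    and "group_representation G \<pi>"
    and "uniformly_bounded_rep G \<pi>"
    and "c0_rep G \<pi>"
    and "superreflexive TYPE('e)"
  shows "trivial_group (H1_red G \<pi>) \<and> (\<forall>b\<in>cocycles G \<pi>. b \<in> almost_coboundaries G \<pi>)"
proof -
  note one = group_representation_one[OF assms(1,6)]
  note mult = group_representation_mult[OF assms(1,6)]
  obtain P where P: "norm_on_type P" "\<And>g x. g \<in> carrier G \<Longrightarrow> P (\<pi> g x) = P x"
    and equiv: "\<exists>c>0. \<exists>C>0. \<forall>x. c * norm x \<le> P x \<and> P x \<le> C * norm x"
    and uc: "\<And>\<epsilon>. 0 < \<epsilon> \<Longrightarrow> \<exists>\<delta>>0. \<forall>x y. P x \<le> 1 \<longrightarrow> P y \<le> 1 \<longrightarrow> \<epsilon> \<le> P (x - y)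
      \<longrightarrow> P ((1/2) *\<^sub>R (x + y)) \<le> 1 - \<delta>"
    using invariant_uniformly_convex_norm[OF assms(1) one mult assms(7,9)] by blast
  obtain c C where c: "0 < c" "\<And>x. c * norm x \<le> P x" and C: "\<And>x. P x \<le> C * norm x"
    using equiv by blast
  obtain F where F: "controlled_folner_sequence G S F"
    using assms(5) by blast
  interpret isometric_rep G S \<pi> P
    using assms(1-3) P one mult
    by (simp add: isometric_rep_def isometric_rep_axioms_def word_group_def word_group_axioms_def)
  have all: "b \<in> almost_coboundaries G \<pi>" if b: "b \<in> cocycles G \<pi>" for b
  proof (rule almost_coboundariesI[OF assms(1,6) b])
    fix T :: "'g set" and e :: real
    assume T: "finite T" "T \<subseteq> carrier G" and "0 < e"
    have coc: "cocycle b"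
      using b by (simp add: cocycles_def cocycle_def)
    note sublinear = cocycle_sublinear[OF coc assms(8) C uc]
    \<comment> \<open>The tolerance \<open>c * e\<close> converts back to \<open>e\<close> in the
      original norm through \<open>c * norm x \<le> P x\<close>.\<close>
    obtain \<xi> where \<xi>: "\<And>g. g \<in> T \<Longrightarrow> P (coboundary_defect b \<xi> g) < c * e"
      using sublinear_cocycle_approximation[OF coc F sublinear T, of "c * e"] c(1) \<open>0 < e\<close> by auto
    have "norm (b g - (\<pi> g \<xi> - \<xi>)) < e" if "g \<in> T" for g
    proof -
      have "c * norm (b g - (\<pi> g \<xi> - \<xi>)) < c * e"
        using \<xi>[OF that] c(2) unfolding coboundary_defect_def by (rule le_less_trans[rotated])
      then show ?thesis using c(1) by simp
    qed
    then show "\<exists>\<xi>. \<forall>g\<in>T. norm (b g - (\<pi> g \<xi> - \<xi>)) < e"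
      by blast
  qed
  then have "almost_coboundaries G \<pi> = carrier (cocycle_group G \<pi>)"
    using almost_coboundaries_subset_cocycles[of G \<pi>] by (auto simp: cocycle_group_def)
  moreover have "group (cocycle_group G \<pi>)"
    using comm_group_cocycle_group[OF assms(1)] by (rule comm_group.axioms(2))
  ultimately have "trivial_group (H1_red G \<pi>)"
    unfolding H1_red_def by (simp add: trivial_group_Mod_carrier)
  with all show ?thesis by blast
qed

end
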